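(* Let $X\subset\mathcal A^{\mathbb N}$ be a sofic subshift with a finite vertex-labelled graph presentation $G=(V,E,\ell)$, let $C_1,\ldots,C_M$ be all the strongly connected components of $G$, and set $K=R(X)$. Then the box dimension of $K$ exists and $$\dim_{\mathrm B}K=\frac1{\log n_s}\max_{(D_1,\ldots,D_s)}\sum_{i=1}^s a_i h_i(D_i),$$ where the maximum is over component chains $(D_1,\ldots,D_s)$ with $D_i\in\{C_1,\ldots,C_M\}$, and $h_i(C)=h_{\mathrm{top}}(\tau_i(X_C))$.
   Context: Let $\Lambda=\operatorname{diag}(m_1,\ldots,m_d)$ with integers $m_1\ge\cdots\ge m_d\ge2$, and let $\mathcal A=\prod_{r=1}^d\{0,\ldots,m_r-1\}\subset\mathbb Z^d$. Let $n_1>\cdots>n_s$ be the distinct values of $m_1,\ldots,m_d$, assume $s\ge2$, and let $0=d_0<d_1<\cdots<d_s=d$ with $m_r=n_i$ for $d_{i-1}<r\le d_i$. Let $\tau_1$ be the identity and, for $2\le i\le s$, let $\tau_i$ delete the coordinates numbered at most $d_{i-1}$ from a digit in $\mathcal A$; $\tau_i$ is applied digitwise to words and sequences. Put $\theta_0=0$, $\theta_i=\log n_s/\log n_i$, $a_i=\theta_i-\theta_{i-1}$ for $1\le i\le s$. The coding map is $R(x)=\sum_{k\ge1}\Lambda^{-k}x_k$. A subshift is a nonempty closed set of sequences over a finite alphabet mapped into itself by the left shift; $h_{\mathrm{top}}(Y)=\lim_{N\to\infty}\frac1N\log\#\mathcal L_N(Y)$, where $\mathcal L_N(Y)$ is the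 set of length-$N$ prefixes of sequences in $Y$ (natural logarithm). A finite vertex-labelled graph presentation $G=(V,E,\ell)$ of $X$ consists of a finite vertex set $V$, an edge set $E\subset V\times V$ and a label map $\ell:V\to\mathcal A$ with $X=\ell(\Sigma_G)$, where $\Sigma_G=\{(v_k)_{k\ge1}\in V^{\mathbb N}:(v_k,v_{k+1})\in E\ \forall k\ge1\}$ and $\ell$ is applied coordinatewise. $X$ is sofic if it has such a presentation. A directed path from $u$ to $v$ is a sequence $u=v_0,v_1,\ldots,v_r=v$, $r\ge1$, with $(v_{l-1},v_l)\in E$ for each $l$; then $v$ is reachable from $u$. A nonempty $C\subset V$ is strongly connected if for all $u,v\in C$ there is a directed path from $u$ to $v$; a strongly connected component is a maximal strongly connected subset of $V$ (so a vertex lies in a component iff it lies on a directed cycle). For a component $C$, $\Sigma_C=\{v\in\Sigma_G:v_k\in C\ \forall k\}$ and $X_C=\ell(\Sigma_C)$. A tuple $(D_1,\ldots,D_r)$ of strongly connected components is a component chain if for every $1\le j<r$ either $D_j=D_{j+1}$ or a vertex of $D_{j+1}$ is reachable from a vertex of $D_j$. *)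

theory Defs
  imports "HOL-Analysis.Analysis"
begin

section \<open>Symbolic dynamics\<close>

text \<open>One-sided sequences over \<open>'a\<close> are functions \<^typ>\<open>nat \<Rightarrow> 'a\<close>, indexed from \<open>0\<close>: the symbol
  \<open>x k\<close> is the \<open>(k + 1)\<close>-st one.\<close>

definition shift :: "(nat \<Rightarrow> 'a) \<Rightarrow> nat \<Rightarrow> 'a" where
  "shift x = (\<lambda>k. x (Suc k))"

definition subshift :: "'a set \<Rightarrow> (nat \<Rightarrow> 'a) set \<Rightarrow> bool" where
  "subshift A Y \<longleftrightarrow> finite A \<and> Y \<noteq> {} \<and>
     closedin (product_topology (\<lambda>_. discrete_topology A) UNIV) Y \<and> shift ` Y \<subseteq> Y"

definition prefixes :: "nat \<Rightarrow> (nat \<Rightarrow> 'a) set \<Rightarrow> 'a list set" where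
  "prefixes N Y = (\<lambda>y. map y [0..<N]) ` Y"

definition htop :: "(nat \<Rightarrow> 'a) set \<Rightarrow> real" where
  "htop Y = lim (\<lambda>N. ln (real (card (prefixes N Y))) / real N)"

section \<open>Graph presentations\<close>

definition walks :: "'v set \<Rightarrow> ('v \<times> 'v) set \<Rightarrow> (nat \<Rightarrow> 'v) set" where
  "walks V E = {v. \<forall>k. v k \<in> V \<and> (v k, v (Suc k)) \<in> E}"

definition label_image :: "('v \<Rightarrow> 'a) \<Rightarrow> (nat \<Rightarrow> 'v) set \<Rightarrow> (nat \<Rightarrow> 'a) set" where
  "label_image lab S = (\<lambda>v. lab \<circ> v) ` S"

definition graph_presentation ::
    "'a set \<Rightarrow> 'v set \<Rightarrow> ('v \<times> 'v) set \<Rightarrow> ('v \<Rightarrow> 'a) \<Rightarrow> (nat \<Rightarrow> 'a) set \<Rightarrow> bool" where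
  "graph_presentation A V E lab X \<longleftrightarrow>
     finite V \<and> E \<subseteq> V \<times> V \<and> lab \<in> V \<rightarrow> A \<and> X = label_image lab (walks V E)"

text \<open>A directed path has length at least one, so reachability is \<^term>\<open>E\<^sup>+\<close>, not \<^term>\<open>E\<^sup>*\<close>;
  a single vertex is strongly connected only if it lies on a cycle.\<close>

definition strongly_connected :: "'v set \<Rightarrow> ('v \<times> 'v) set \<Rightarrow> 'v set \<Rightarrow> bool" where
  "strongly_connected V E C \<longleftrightarrow> C \<noteq> {} \<and> C \<subseteq> V \<and> (\<forall>u\<in>C. \<forall>v\<in>C. (u, v) \<in> E\<^sup>+)"

definition components :: "'v set \<Rightarrow> ('v \<times> 'v) set \<Rightarrow> 'v set set" where
  "components V E = {C. strongly_connected V E C \<and>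
     (\<forall>C'. strongly_connected V E C' \<and> C \<subseteq> C' \<longrightarrow> C' = C)}"

definition component_walks :: "'v set \<Rightarrow> ('v \<times> 'v) set \<Rightarrow> 'v set \<Rightarrow> (nat \<Rightarrow> 'v) set" where
  "component_walks V E C = {v \<in> walks V E. \<forall>k. v k \<in> C}"

text \<open>Component chains of length \<open>r\<close>, as extensional functions on \<open>{1..r}\<close>.\<close>

definition component_chains :: "'v set \<Rightarrow> ('v \<times> 'v) set \<Rightarrow> nat \<Rightarrow> (nat \<Rightarrow> 'v set) set" where
  "component_chains V E r = {D \<in> {1..r} \<rightarrow>\<^sub>E components V E.
     \<forall>j. 1 \<le> j \<and> j < r \<longrightarrow>
       D j = D (j + 1) \<or> (\<exists>u\<in>D j. \<exists>v\<in>D (j + 1). (u, v) \<in> E\<^sup>+)}"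

section \<open>Box dimension\<close>

text \<open>The least number of sets of diameter at most \<open>\<delta>\<close> needed to cover \<open>K\<close>, for bounded \<open>K\<close> in
  Euclidean space. Boundedness of the covering sets is explicit since \<^const>\<open>diameter\<close> is
  unspecified on unbounded sets.\<close>

definition covering_number :: "'a::metric_space set \<Rightarrow> real \<Rightarrow> nat" where
  "covering_number K \<delta> = (LEAST n. \<exists>F. finite F \<and> card F = n \<and> K \<subseteq> \<Union>F \<and>
     (\<forall>U\<in>F. bounded U \<and> diameter U \<le> \<delta>))"

text \<open>The box dimension of \<open>K\<close> exists and equals \<open>D\<close>.\<close>

definition has_box_dimension :: "'a::metric_space set \<Rightarrow> real \<Rightarrow> bool" where
  "has_box_dimension K D \<longleftrightarrow>
     ((\<lambda>\<delta>. ln (real (covering_number K \<delta>)) / - ln \<delta>) \<longlongrightarrow> D) (at_right 0)"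

section \<open>Digits and the coding map\<close>

text \<open>The coordinates \<open>1, \<dots>, d\<close> are the elements of a finite linearly ordered type \<open>'d\<close>, so
  \<open>d = CARD('d)\<close>; \<open>coord_num r\<close> is the number of the coordinate \<open>r\<close>. Digits are integer vectors
  \<^typ>\<open>'d \<Rightarrow> int\<close>, and \<open>m\<close> gives the diagonal of \<open>\<Lambda>\<close>.\<close>

definition coord_num :: "'d::{finite,linorder} \<Rightarrow> nat" where
  "coord_num r = card {..r}"

lemma bij_betw_coord_num: "bij_betw (coord_num :: 'd::{finite,linorder} \<Rightarrow> nat) UNIV {1..CARD('d)}"
proof -
  have less: "coord_num x < coord_num y" if "x < y" for x y :: 'd
    unfolding coord_num_def using that by (intro psubset_card_mono) auto
  have inj: "inj (coord_num :: 'd \<Rightarrow> nat)"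
    by (rule linorder_injI) (metis less less_irrefl)
  have "card {..x} \<noteq> 0" for x :: 'd
    by auto
  then have "range (coord_num :: 'd \<Rightarrow> nat) \<subseteq> {1..CARD('d)}"
    unfolding coord_num_def by (auto simp: Suc_le_eq card_gt_0_iff intro!: card_mono)
  moreover have "card (range (coord_num :: 'd \<Rightarrow> nat)) = CARD('d)"
    using inj by (rule card_image)
  ultimately have "range (coord_num :: 'd \<Rightarrow> nat) = {1..CARD('d)}"
    by (intro card_subset_eq) auto
  with inj show ?thesis
    by (simp add: bij_betw_def)
qed

definition digits :: "('d \<Rightarrow> nat) \<Rightarrow> ('d \<Rightarrow> int) set" where
  "digits m = {a. \<forall>r. 0 \<le> a r \<and> a r < int (m r)}"

text \<open>Since sequences are indexed from \<open>0\<close>, the \<open>k\<close>-th summand is \<open>\<Lambda>\<close> to the power \<open>- (k + 1)\<close>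
  applied to \<open>x k\<close>.\<close>

definition coding_map :: "('d::finite \<Rightarrow> nat) \<Rightarrow> (nat \<Rightarrow> 'd \<Rightarrow> int) \<Rightarrow> real ^ 'd" where
  "coding_map m x = (\<Sum>k. \<chi> r. real_of_int (x k r) / real (m r) ^ (k + 1))"

text \<open>Deletion of coordinates is restriction to the remaining ones; \<open>dd i\<close> is the number
  of coordinates in the first \<open>i\<close> blocks. As \<open>dd 0 = 0\<close> and coordinate
  numbers start at \<open>1\<close>, nothing is deleted for \<open>i = 1\<close>.\<close>

definition tau :: "(nat \<Rightarrow> nat) \<Rightarrow> nat \<Rightarrow> ('d::{finite,linorder} \<Rightarrow> int) \<Rightarrow> 'd \<Rightarrow> int" where
  "tau dd i a = restrict a {r. dd (i - 1) < coord_num r}"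

lemma tau_1:
  assumes "dd 0 = 0"
  shows "tau dd 1 = (id :: ('d::{finite,linorder} \<Rightarrow> int) \<Rightarrow> _)"
proof -
  have "0 < coord_num r" for r :: 'd
    using bij_betw_coord_num by (force simp: bij_betw_def Suc_le_eq)
  with assms show ?thesis
    by (auto simp: tau_def restrict_def)
qed

definition theta :: "(nat \<Rightarrow> nat) \<Rightarrow> nat \<Rightarrow> nat \<Rightarrow> real" where
  "theta n s i = (if i = 0 then 0 else ln (real (n s)) / ln (real (n i)))"

definition component_entropy ::
    "(nat \<Rightarrow> nat) \<Rightarrow> 'v set \<Rightarrow> ('v \<times> 'v) set \<Rightarrow> ('v \<Rightarrow> 'd::{finite,linorder} \<Rightarrow> int) \<Rightarrow> nat \<Rightarrow> 'v set \<Rightarrow> real" where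
  "component_entropy dd V E lab i C =
     htop ((\<lambda>x. tau dd i \<circ> x) ` label_image lab (component_walks V E C))"

end

(*
  Let N(L) be the number of approximate squares met by X when the coordinates of block i are read
  up to digit L_i. Between the digits L_(i-1) and L_i exactly the coordinates kept by tau_i are
  visible, so up to a bounded factor N(L) is the largest product, over intermediate vertices
  u_0, ..., u_s, of the numbers of tau_i-words along paths of length L_i - L_(i-1) from u_(i-1)
  to u_i. Splitting a path at its exit from the component of its first vertex shows that such a
  number grows at most like exp((h_i(D) + epsilon) (L_i - L_(i-1))) for some component D between
  u_(i-1) and u_i, and the components obtained for i = 1, ..., s form a chain. Conversely each
  chain is realised by entering its components after a bounded number of steps. With
  L_i = log(1/delta) / log n_i + O(1), the numbers N(L) and the covering numbers at scale delta
  agree up to a constant factor.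
*)
theory Submission
  imports Defs
begin

text \<open>Words are counted, not paths. Different paths may carry one word, so counts multiply
  from below only at a fixed junction, while from above they are bounded by a sum over junctions;
  finiteness of \<open>V\<close> reduces each such sum to its largest term. Only one rate survives
  when a segment crosses several components: summing products of exponentials over the exit times
  gives the largest rate up to a polynomial factor, and this factor is what \<epsilon> absorbs.
  Between fixed intermediate vertices the best component of each segment can then be chosen
  independently, because a chain asks for nothing but reachability. The weights arise from L_i /
  log(1/delta) -> 1 / log n_i: the increments 1 / log n_i - 1 / log n_(i-1), with 0 in place of the
  second term for i = 1, equal a_i / log n_s. They are positive because the n_i decrease, so every
  segment eventually exceeds \<open>card V\<close> and \<open>card E\<close>. Beyond the first
  threshold a segment must meet a component; beyond the second there is time to enter a prescribed
  one.\<close>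

section \<open>Words along paths\<close>

text \<open>The label functions in the list vary along the path, because the approximate squares see
  different coordinates at different positions.\<close>

fun path_words :: "('v \<times> 'v) set \<Rightarrow> ('v \<Rightarrow> 'b) list \<Rightarrow> 'v \<Rightarrow> 'v \<Rightarrow> 'b list set" where
  "path_words E [] u v = (if u = v then {[]} else {})"
| "path_words E (g # gs) u v = (\<Union>u'\<in>E `` {u}. (#) (g u) ` path_words E gs u' v)"

lemma finite_path_words: "finite E \<Longrightarrow> finite (path_words E gs u v)"
  by (induction gs arbitrary: u) auto

lemma path_words_mono: "E \<subseteq> F \<Longrightarrow> path_words E gs u v \<subseteq> path_words F gs u v"
proof (induction gs arbitrary: u)
  case (Cons g gs)
  then show ?case by simp blast
qed auto

lemma length_path_words: "w \<in> path_words E gs u v \<Longrightarrow> length w = length gs"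
  by (induction gs arbitrary: u w) (auto split: if_splits)

text \<open>The end vertex of a path carries no letter, so concatenation reads the junction
  \<open>x\<close> only in the second part.\<close>

lemma path_words_append_iff:
  "w \<in> path_words E (gs @ hs) u v \<longleftrightarrow>
    (\<exists>x a b. w = a @ b \<and> a \<in> path_words E gs u x \<and> b \<in> path_words E hs x v)"
proof (induction gs arbitrary: u w)
  case (Cons g gs)
  show ?case
  proof
    assume "w \<in> path_words E ((g # gs) @ hs) u v"
    then obtain u' w' where w': "(u, u') \<in> E" "w' \<in> path_words E (gs @ hs) u' v" "w = g u # w'"
      by auto
    then obtain x a b where "w' = a @ b" "a \<in> path_words E gs u' x" "b \<in> path_words E hs x v"
      using Cons.IH by auto
    then have "w = (g u # a) @ b \<and> g u # a \<in> path_words E (g # gs) u x \<and> b \<in> path_words E hs x v"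
      using w' by auto
    then show "\<exists>x a b. w = a @ b \<and> a \<in> path_words E (g # gs) u x \<and> b \<in> path_words E hs x v"
      by blast
  next
    assume "\<exists>x a b. w = a @ b \<and> a \<in> path_words E (g # gs) u x \<and> b \<in> path_words E hs x v"
    then obtain x u' a' b where "(u, u') \<in> E" "w = (g u # a') @ b" "a' \<in> path_words E gs u' x"
      "b \<in> path_words E hs x v"
      by auto
    moreover from this have "a' @ b \<in> path_words E (gs @ hs) u' v"
      using Cons.IH by blast
    ultimately show "w \<in> path_words E ((g # gs) @ hs) u v"
      by auto
  qed
qed auto

lemma path_words_append:
  "path_words E (gs @ hs) u v =
    (\<Union>x. (\<lambda>(a, b). a @ b) ` (path_words E gs u x \<times> path_words E hs x v))"
  by (rule set_eqI) (simp only: path_words_append_iff, force)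

lemma path_words_nonempty_iff: "path_words E gs u v \<noteq> {} \<longleftrightarrow> (u, v) \<in> E ^^ length gs"
proof (induction gs arbitrary: u)
  case (Cons g gs)
  have "path_words E (g # gs) u v \<noteq> {} \<longleftrightarrow> (\<exists>u'. (u, u') \<in> E \<and> path_words E gs u' v \<noteq> {})"
    by auto
  also have "\<dots> \<longleftrightarrow> (u, v) \<in> E ^^ length (g # gs)"
    unfolding Cons.IH length_Cons by (metis relpow_Suc_I2 relpow_Suc_E2)
  finally show ?case .
qed auto

text \<open>The label lists fix the lengths, so a concatenated word determines both factors and
  distinct pairs give distinct words.\<close>

lemma card_path_words_append_ge:
  assumes "finite E"
  shows "card (path_words E gs u x) * card (path_words E hs x v) \<le> card (path_words E (gs @ hs) u v)"
proof -
  have "inj_on (\<lambda>(a, b). a @ b) (path_words E gs u x \<times> path_words E hs x v)"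
    by (auto simp: inj_on_def) (metis length_path_words append_eq_append_conv)+
  then have "card (path_words E gs u x) * card (path_words E hs x v) =
      card ((\<lambda>(a, b). a @ b) ` (path_words E gs u x \<times> path_words E hs x v))"
    by (simp add: card_image card_cartesian_product)
  also have "\<dots> \<le> card (path_words E (gs @ hs) u v)"
    by (intro card_mono finite_path_words assms) (auto simp: path_words_append)
  finally show ?thesis .
qed

lemma path_words_closed:
  assumes "path_words E gs u v \<noteq> {}" "E \<subseteq> V \<times> V" "u \<in> V"
  shows "v \<in> V"
proof (cases "u = v")
  case False
  have "(u, v) \<in> E\<^sup>*"
    using assms(1) unfolding path_words_nonempty_iff by (rule relpow_imp_rtrancl)
  then have "(u, v) \<in> E\<^sup>+"
    using False by (auto simp: rtrancl_eq_or_trancl)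
  then show ?thesis
    using trancl_subset_Sigma[OF assms(2)] by auto
qed (use assms in auto)

text \<open>Different junctions can produce the same word, so only a sum bounds the count from
  above; \<open>u \<in> V\<close> keeps the relevant junctions in the finite set
  \<open>V\<close>.\<close>

lemma card_path_words_append_le:
  assumes "finite V" "E \<subseteq> V \<times> V" "u \<in> V"
  shows "card (path_words E (gs @ hs) u v) \<le>
    (\<Sum>x\<in>V. card (path_words E gs u x) * card (path_words E hs x v))"
proof -
  have fin: "finite E"
    using assms finite_subset by auto
  have "path_words E (gs @ hs) u v =
      (\<Union>x\<in>V. (\<lambda>(a, b). a @ b) ` (path_words E gs u x \<times> path_words E hs x v))"
    unfolding path_words_append using path_words_closed[OF _ assms(2,3)] by fastforce
  also have "card \<dots> \<le> (\<Sum>x\<in>V. card ((\<lambda>(a, b). a @ b) ` (path_words E gs u x \<times> path_words E hs x v)))"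
    by (rule card_UN_le) fact
  also have "\<dots> \<le> (\<Sum>x\<in>V. card (path_words E gs u x \<times> path_words E hs x v))"
    by (intro sum_mono card_image_le finite_cartesian_product finite_path_words fin)
  finally show ?thesis
    by (simp add: card_cartesian_product)
qed

lemma walk_in_path_words:
  assumes "\<And>k. (\<omega> k, \<omega> (Suc k)) \<in> E"
  shows "map (\<lambda>k. (gs ! k) (\<omega> k)) [0..<length gs] \<in> path_words E gs (\<omega> 0) (\<omega> (length gs))"
  using assms
proof (induction gs arbitrary: \<omega>)
  case (Cons g gs)
  have "map (\<lambda>k. (gs ! k) (\<omega> (Suc k))) [0..<length gs] \<in> path_words E gs (\<omega> (Suc 0)) (\<omega> (Suc (length gs)))"
    using Cons.IH[of "\<lambda>k. \<omega> (Suc k)"] Cons.prems by simp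
  moreover have "map (\<lambda>k. ((g # gs) ! k) (\<omega> k)) [0..<length (g # gs)] =
      g (\<omega> 0) # map (\<lambda>k. (gs ! k) (\<omega> (Suc k))) [0..<length gs]"
    by (simp add: upt_conv_Cons map_Suc_upt[symmetric] del: upt_Suc)
  ultimately show ?case
    using Cons.prems[of 0] by auto
qed auto

text \<open>Links finite counting with infinite sequences: a word along a path into \<open>v\<close>
  is read off an infinite walk as soon as some walk starts at \<open>v\<close>.\<close>

lemma path_word_extends:
  assumes "w \<in> path_words E gs u v" "\<And>k. (\<omega> k, \<omega> (Suc k)) \<in> E" "\<omega> 0 = v"
  obtains \<omega>' where "\<omega>' 0 = u" "\<And>k. (\<omega>' k, \<omega>' (Suc k)) \<in> E"
    "w = map (\<lambda>k. (gs ! k) (\<omega>' k)) [0..<length gs]"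
proof -
  have "\<exists>\<omega>'. \<omega>' 0 = u \<and> (\<forall>k. (\<omega>' k, \<omega>' (Suc k)) \<in> E) \<and> w = map (\<lambda>k. (gs ! k) (\<omega>' k)) [0..<length gs]"
    using assms(1)
  proof (induction gs arbitrary: u w)
    case Nil
    then show ?case using assms(2,3) by (auto split: if_splits)
  next
    case (Cons g gs)
    then obtain u' w' where w': "(u, u') \<in> E" "w' \<in> path_words E gs u' v" "w = g u # w'"
      by auto
    obtain \<omega>' where \<omega>': "\<omega>' 0 = u'" "\<And>k. (\<omega>' k, \<omega>' (Suc k)) \<in> E"
      "w' = map (\<lambda>k. (gs ! k) (\<omega>' k)) [0..<length gs]"
      using Cons.IH[OF w'(2)] by auto
    define \<omega>'' where "\<omega>'' = case_nat u \<omega>'"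
    have "(\<omega>'' k, \<omega>'' (Suc k)) \<in> E" for k
      using w' \<omega>' by (cases k) (auto simp: \<omega>''_def)
    moreover have "w = map (\<lambda>k. ((g # gs) ! k) (\<omega>'' k)) [0..<length (g # gs)]"
      by (simp add: upt_conv_Cons map_Suc_upt[symmetric] w' \<omega>' \<omega>''_def del: upt_Suc)
    ultimately show ?case
      by (intro exI[of _ \<omega>'']) (auto simp: \<omega>''_def)
  qed
  then show ?thesis using that by auto
qed

text \<open>Ending inside \<open>D\<close> matters when \<open>D\<close> is a component: the path
  can then be prolonged within \<open>D\<close> forever, so its word is a prefix of a sequence of
  the component.\<close>

definition inner_words :: "('v \<times> 'v) set \<Rightarrow> 'v set \<Rightarrow> ('v \<Rightarrow> 'b) \<Rightarrow> nat \<Rightarrow> 'v \<Rightarrow> 'b list set" where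
  "inner_words E D g l u = (\<Union>x\<in>D. path_words (E \<inter> D \<times> D) (replicate l g) u x)"

lemma inner_words_Suc:
  "u \<in> D \<Longrightarrow> u' \<in> D \<Longrightarrow> (u, u') \<in> E \<Longrightarrow> w \<in> inner_words E D g l u' \<Longrightarrow>
    g u # w \<in> inner_words E D g (Suc l) u"
  unfolding inner_words_def by auto

lemma path_words_leave:
  assumes "w \<in> path_words E (replicate l g) u v" "u \<in> D"
  shows "w \<in> inner_words E D g l u \<or>
    (\<exists>j<l. \<exists>x\<in>D. \<exists>u'. u' \<notin> D \<and> (x, u') \<in> E \<and>
      (\<exists>a b. w = a @ g x # b \<and> a \<in> inner_words E D g j u \<and>
        b \<in> path_words E (replicate (l - Suc j) g) u' v))"
  using assms
proof (induction l arbitrary: u w)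
  case 0
  then show ?case by (auto simp: inner_words_def split: if_splits)
next
  case (Suc l)
  then obtain u' w' where w': "(u, u') \<in> E" "w' \<in> path_words E (replicate l g) u' v" "w = g u # w'"
    by auto
  show ?case
  proof (cases "u' \<in> D")
    \<comment> \<open>Immediate exit: \<open>x = u\<close>, with no letters before it.\<close>
    case False
    have "[] \<in> inner_words E D g 0 u"
      using Suc.prems by (auto simp: inner_words_def)
    then have "w = [] @ g u # w' \<and> [] \<in> inner_words E D g 0 u \<and>
        w' \<in> path_words E (replicate (Suc l - Suc 0) g) u' v"
      using w' by simp
    then show ?thesis
      using False Suc.prems(2) w'(1) by blast
  next
    case True
    from Suc.IH[OF w'(2) True] show ?thesis
    proof (elim disjE exE bexE conjE)
      assume "w' \<in> inner_words E D g l u'"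
      then show ?thesis
        using inner_words_Suc[OF Suc.prems(2) True w'(1)] w'(3) by blast
    next
      fix j x y a b
      assume *: "j < l" "x \<in> D" "y \<notin> D" "(x, y) \<in> E" "w' = a @ g x # b"
        "a \<in> inner_words E D g j u'" "b \<in> path_words E (replicate (l - Suc j) g) y v"
      have "g u # a \<in> inner_words E D g (Suc j) u"
        using inner_words_Suc[OF Suc.prems(2) True w'(1) *(6)] .
      then have "w = (g u # a) @ g x # b \<and> g u # a \<in> inner_words E D g (Suc j) u \<and>
          b \<in> path_words E (replicate (Suc l - Suc (Suc j)) g) y v"
        using * w' by simp
      moreover have "Suc j < Suc l" using * by simp
      ultimately show ?thesis
        using *(2-4) by blast
    qed
  qed
qed

section \<open>Entropy\<close>

text \<open>The limit is the infimum of the quotients. This is why the lower bound holds for every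
  \<open>n\<close> without a constant, while the upper bound has both \<epsilon> and an additive
  constant.\<close>

lemma fekete:
  fixes a :: "nat \<Rightarrow> real"
  assumes nonneg: "\<And>n. 0 \<le> a n" and subadd: "\<And>m n. a (m + n) \<le> a m + a n"
  obtains h where "0 \<le> h" "\<And>n. h * real n \<le> a n" "(\<lambda>n. a n / real n) \<longlonglongrightarrow> h"
    "\<And>\<epsilon>. 0 < \<epsilon> \<Longrightarrow> \<exists>C. \<forall>n. a n \<le> (h + \<epsilon>) * real n + C"
proof -
  define S where "S = (\<lambda>n. a n / real n) ` {1..}"
  define h where "h = Inf S"
  have bdd: "bdd_below S"
    unfolding S_def by (rule bdd_belowI2[of _ 0]) (simp add: nonneg)
  have S_ne: "S \<noteq> {}"
    unfolding S_def by auto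
  have h_nonneg: "0 \<le> h"
    unfolding h_def by (rule cInf_greatest[OF S_ne]) (auto simp: S_def nonneg)
  have lower: "h * real n \<le> a n" for n
  proof (cases "n = 0")
    case False
    then have "h \<le> a n / real n"
      unfolding h_def using bdd by (intro cInf_lower) (auto simp: S_def)
    with False show ?thesis
      by (simp add: field_simps)
  qed (simp add: nonneg)
  have upper: "\<exists>C. \<forall>n. a n \<le> (h + \<epsilon>) * real n + C" if "0 < \<epsilon>" for \<epsilon>
  proof -
    have "\<exists>z\<in>S. z < h + \<epsilon>"
      using that S_ne bdd cInf_less_iff[of S "h + \<epsilon>"] unfolding h_def by auto
    then obtain k where k: "1 \<le> k" "a k / real k < h + \<epsilon>"
      unfolding S_def by auto
    \<comment> \<open>The term \<open>a 0\<close> accounts for \<open>q = 0\<close>, where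
      subadditivity does not force the value to vanish.\<close>
    have mult: "a (q * k) \<le> real q * a k + a 0" for q
    proof (induction q)
      case (Suc q)
      have "a (Suc q * k) \<le> a k + a (q * k)"
        using subadd[of k "q * k"] by simp
      with Suc show ?case by (simp add: algebra_simps)
    qed simp
    \<comment> \<open>Division with remainder by the near-optimal \<open>k\<close>; the sum over all
      residues dominates \<open>a (n mod k)\<close> uniformly in \<open>n\<close>.\<close>
    have "a n \<le> (h + \<epsilon>) * real n + (a 0 + (\<Sum>r<k. a r))" for n
    proof -
      have "a n = a (n div k * k + n mod k)" by simp
      also have "\<dots> \<le> a (n div k * k) + a (n mod k)" by (rule subadd)
      also have "a (n mod k) \<le> (\<Sum>r<k. a r)"
        using k by (intro member_le_sum) (auto simp: nonneg)
      also have "a (n div k * k) \<le> real (n div k) * a k + a 0" by (rule mult)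
      also have "real (n div k) * a k \<le> real (n div k) * ((h + \<epsilon>) * real k)"
        using k by (intro mult_left_mono) (auto simp: field_simps)
      also have "real (n div k) * ((h + \<epsilon>) * real k) = (h + \<epsilon>) * real (n div k * k)"
        by simp
      also have "\<dots> \<le> (h + \<epsilon>) * real n"
        using h_nonneg that by (intro mult_left_mono of_nat_mono) auto
      finally show ?thesis by simp
    qed
    then show ?thesis by blast
  qed
  have "(\<lambda>n. a n / real n) \<longlonglongrightarrow> h"
  proof (rule order_tendstoI)
    fix y assume "y < h"
    moreover have "h \<le> a n / real n" if "n > 0" for n
      using lower[of n] that by (simp add: field_simps)
    ultimately show "eventually (\<lambda>n. y < a n / real n) sequentially"
      by (intro eventually_mono[OF eventually_gt_at_top[of 0]]) (auto intro: less_le_trans)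
  next
    fix y assume y: "h < y"
    define \<epsilon> where "\<epsilon> = (y - h) / 2"
    have "0 < \<epsilon>" using y by (simp add: \<epsilon>_def)
    from upper[OF this] obtain C where C: "\<And>n. a n \<le> (h + \<epsilon>) * real n + C" by auto
    have "((\<lambda>n. (h + \<epsilon>) + C / real n) \<longlongrightarrow> (h + \<epsilon>) + 0) sequentially"
      by (intro tendsto_intros lim_const_over_n)
    moreover have "(h + \<epsilon>) + 0 < y" using y by (simp add: \<epsilon>_def field_simps)
    ultimately have "eventually (\<lambda>n. (h + \<epsilon>) + C / real n < y) sequentially"
      by (rule order_tendstoD)
    then show "eventually (\<lambda>n. a n / real n < y) sequentially"
      using eventually_gt_at_top[of 0]
    proof eventually_elim
      case (elim n)
      have "a n / real n \<le> ((h + \<epsilon>) * real n + C) / real n"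
        by (intro divide_right_mono C) simp
      also have "\<dots> = (h + \<epsilon>) + C / real n" using elim by (simp add: field_simps)
      finally show ?case using elim by simp
    qed
  qed
  then show ?thesis
    using that h_nonneg lower upper by blast
qed

lemma funpow_shift: "(shift ^^ M) y = (\<lambda>k. y (M + k))"
  by (induction M arbitrary: y) (auto simp: shift_def fun_eq_iff)

lemma prefixes_add_subset:
  assumes "shift ` Y \<subseteq> Y"
  shows "prefixes (M + N) Y \<subseteq> (\<lambda>(a, b). a @ b) ` (prefixes M Y \<times> prefixes N Y)"
proof
  fix w assume "w \<in> prefixes (M + N) Y"
  then obtain y where y: "y \<in> Y" "w = map y [0..<M + N]"
    by (auto simp: prefixes_def)
  have "(shift ^^ M) y \<in> Y"
    using y(1) assms by (induction M) auto
  moreover have "w = map y [0..<M] @ map ((shift ^^ M) y) [0..<N]"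
    unfolding y(2) funpow_shift by (rule nth_equalityI) (auto simp: nth_append)
  ultimately show "w \<in> (\<lambda>(a, b). a @ b) ` (prefixes M Y \<times> prefixes N Y)"
    using y(1) unfolding prefixes_def by fastforce
qed

text \<open>Logarithms of prefix counts are subadditive, since a prefix of length
  \<open>M + N\<close> splits into two shorter prefixes; shift invariance provides the second
  one.\<close>

lemma htop_bounds:
  assumes "Y \<noteq> {}" "shift ` Y \<subseteq> Y" "\<And>N. finite (prefixes N Y)"
  shows "0 \<le> htop Y" "exp (htop Y * real N) \<le> real (card (prefixes N Y))"
    "0 < \<epsilon> \<Longrightarrow> \<exists>K>0. \<forall>N. real (card (prefixes N Y)) \<le> K * exp ((htop Y + \<epsilon>) * real N)"
proof -
  have pos: "0 < card (prefixes N Y)" for N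
    using assms by (auto simp: card_gt_0_iff prefixes_def)
  have sub: "card (prefixes (M + N) Y) \<le> card (prefixes M Y) * card (prefixes N Y)" for M N
  proof -
    have "card (prefixes (M + N) Y) \<le> card ((\<lambda>(a, b). a @ b) ` (prefixes M Y \<times> prefixes N Y))"
      using assms by (intro card_mono prefixes_add_subset) auto
    also have "\<dots> \<le> card (prefixes M Y \<times> prefixes N Y)"
      using assms by (intro card_image_le) auto
    finally show ?thesis by (simp add: card_cartesian_product)
  qed
  define a where "a N = ln (real (card (prefixes N Y)))" for N
  have "0 \<le> a N" for N
    using pos[of N] by (simp add: a_def)
  moreover have "a (M + N) \<le> a M + a N" for M N
  proof -
    have "a (M + N) \<le> ln (real (card (prefixes M Y) * card (prefixes N Y)))"
      unfolding a_def using pos[of "M + N"] sub[of M N] by (intro ln_mono of_nat_mono) auto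
    also have "\<dots> = a M + a N"
      unfolding a_def using pos[of M] pos[of N] by (simp add: ln_mult)
    finally show ?thesis .
  qed
  ultimately obtain h where h: "0 \<le> h" "\<And>n. h * real n \<le> a n" "(\<lambda>n. a n / real n) \<longlonglongrightarrow> h"
    "\<And>\<epsilon>. 0 < \<epsilon> \<Longrightarrow> \<exists>C. \<forall>n. a n \<le> (h + \<epsilon>) * real n + C"
    using fekete by metis
  \<comment> \<open>\<open>htop\<close> is a \<open>lim\<close>, so it carries information only once
    convergence is known.\<close>
  have htop: "htop Y = h"
    using h(3) unfolding htop_def a_def by (rule limI)
  have exp_a: "exp (a N) = real (card (prefixes N Y))" for N
    using pos[of N] by (simp add: a_def)
  show "0 \<le> htop Y"
    using h(1) htop by simp
  show "exp (htop Y * real N) \<le> real (card (prefixes N Y))"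
    using h(2)[of N] exp_a htop by (metis exp_le_cancel_iff)
  assume "0 < \<epsilon>"
  from h(4)[OF this] obtain C where C: "\<And>n. a n \<le> (h + \<epsilon>) * real n + C" by auto
  have "real (card (prefixes N Y)) \<le> exp C * exp ((htop Y + \<epsilon>) * real N)" for N
    using C[of N] exp_a[of N] htop by (metis add.commute exp_add exp_le_cancel_iff)
  then show "\<exists>K>0. \<forall>N. real (card (prefixes N Y)) \<le> K * exp ((htop Y + \<epsilon>) * real N)"
    by (intro exI[of _ "exp C"]) auto
qed

section \<open>Components\<close>

text \<open>Deleting coordinates is absorbed into the label map \<open>g\<close>, so every tau_i
  (X_C) has this form and one entropy argument serves all blocks.\<close>

definition component_seqs ::
    "'v set \<Rightarrow> ('v \<times> 'v) set \<Rightarrow> ('v \<Rightarrow> 'b) \<Rightarrow> 'v set \<Rightarrow> (nat \<Rightarrow> 'b) set" where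
  "component_seqs V E g D = (\<lambda>\<omega>. g \<circ> \<omega>) ` component_walks V E D"

text \<open>Built from \<open>E\<^sup>*\<close>, so it always contains \<open>u\<close>: a vertex on
  no cycle has a singleton class, which is not a component. Exits can therefore be taken from any
  start vertex.\<close>

definition mutual_class :: "('v \<times> 'v) set \<Rightarrow> 'v \<Rightarrow> 'v set" where
  "mutual_class E u = {x. (u, x) \<in> E\<^sup>* \<and> (x, u) \<in> E\<^sup>*}"

locale finite_digraph =
  fixes V :: "'v set" and E :: "('v \<times> 'v) set"
  assumes finite_V: "finite V" and E_sub: "E \<subseteq> V \<times> V"
begin

lemma finite_E: "finite E"
  using finite_V E_sub finite_subset by auto

lemma component_strongly_connected: "D \<in> components V E \<Longrightarrow> u \<in> D \<Longrightarrow> v \<in> D \<Longrightarrow> (u, v) \<in> E\<^sup>+"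
  unfolding components_def strongly_connected_def by auto

lemma component_nonempty: "D \<in> components V E \<Longrightarrow> D \<noteq> {}"
  and component_subset: "D \<in> components V E \<Longrightarrow> D \<subseteq> V"
  unfolding components_def strongly_connected_def by auto

lemma strongly_connected_mutual_class:
  assumes "(u, u) \<in> E\<^sup>+"
  shows "strongly_connected V E (mutual_class E u)"
proof -
  have "(x, y) \<in> E\<^sup>+" if "x \<in> mutual_class E u" "y \<in> mutual_class E u" for x y
    using that assms unfolding mutual_class_def
    by (auto intro: rtrancl_trancl_trancl trancl_rtrancl_trancl)
  moreover have "u \<in> mutual_class E u"
    by (auto simp: mutual_class_def)
  moreover have "E\<^sup>+ \<subseteq> V \<times> V"
    using E_sub by (rule trancl_subset_Sigma)
  ultimately show ?thesis
    unfolding strongly_connected_def by blast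
qed

lemma component_eq_mutual_class:
  assumes "D \<in> components V E" "u \<in> D"
  shows "D = mutual_class E u"
proof -
  have "D \<subseteq> mutual_class E u"
    using component_strongly_connected[OF assms(1)] assms(2)
    by (auto simp: mutual_class_def intro: trancl_into_rtrancl)
  moreover have "strongly_connected V E (mutual_class E u)"
    using component_strongly_connected[OF assms(1) assms(2) assms(2)]
    by (rule strongly_connected_mutual_class)
  ultimately show ?thesis
    using assms(1) unfolding components_def by blast
qed

lemma mutual_class_component:
  assumes "(u, u) \<in> E\<^sup>+"
  shows "mutual_class E u \<in> components V E"
proof -
  have "C' = mutual_class E u" if "strongly_connected V E C'" "mutual_class E u \<subseteq> C'" for C'
  proof -
    have "u \<in> C'"
      using that(2) by (auto simp: mutual_class_def)
    then have "C' \<subseteq> mutual_class E u"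
      using that(1) unfolding strongly_connected_def
      by (auto simp: mutual_class_def intro: trancl_into_rtrancl)
    with that(2) show ?thesis by blast
  qed
  then show ?thesis
    unfolding components_def using strongly_connected_mutual_class[OF assms] by blast
qed

lemma finite_components: "finite (components V E)"
  by (rule finite_subset[of _ "Pow V"]) (use component_subset finite_V in auto)

text \<open>A closed path through \<open>u\<close> cannot leave the class of \<open>u\<close>, so
  its first step already stays in \<open>D\<close>.\<close>

lemma component_step:
  assumes "D \<in> components V E" "u \<in> D"
  shows "\<exists>x\<in>D. (u, x) \<in> E"
proof -
  have "(u, u) \<in> E\<^sup>+"
    using component_strongly_connected assms by blast
  then obtain x where "(u, x) \<in> E" "(x, u) \<in> E\<^sup>*"
    by (meson tranclD)
  then have "x \<in> mutual_class E u"
    by (auto simp: mutual_class_def)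
  with \<open>(u, x) \<in> E\<close> show ?thesis
    using component_eq_mutual_class[OF assms] by auto
qed

lemma component_walk_exists:
  assumes "D \<in> components V E" "u \<in> D"
  obtains \<omega> where "\<omega> 0 = u" "\<And>k. (\<omega> k, \<omega> (Suc k)) \<in> E \<inter> D \<times> D"
proof -
  obtain f where f: "\<And>u. u \<in> D \<Longrightarrow> f u \<in> D \<and> (u, f u) \<in> E"
    using component_step[OF assms(1)] by metis
  have "(f ^^ k) u \<in> D" for k
    by (induction k) (use assms f in auto)
  then show ?thesis
    using f by (intro that[of "\<lambda>k. (f ^^ k) u"]) auto
qed

lemma inner_words_subset_prefixes:
  assumes "D \<in> components V E" "u \<in> D"
  shows "inner_words E D g l u \<subseteq> prefixes l (component_seqs V E g D)"
proof
  fix w assume "w \<in> inner_words E D g l u"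
  then obtain x where x: "x \<in> D" "w \<in> path_words (E \<inter> D \<times> D) (replicate l g) u x"
    by (auto simp: inner_words_def)
  obtain \<omega> where \<omega>: "\<omega> 0 = x" "\<And>k. (\<omega> k, \<omega> (Suc k)) \<in> E \<inter> D \<times> D"
    using component_walk_exists[OF assms(1) x(1)] by blast
  obtain \<omega>' where \<omega>': "\<And>k. (\<omega>' k, \<omega>' (Suc k)) \<in> E \<inter> D \<times> D"
    "w = map (\<lambda>k. (replicate l g ! k) (\<omega>' k)) [0..<length (replicate l g)]"
    using path_word_extends[OF x(2) \<omega>(2,1)] by blast
  have "\<omega>' \<in> component_walks V E D"
    using \<omega>'(1) component_subset[OF assms(1)] unfolding component_walks_def walks_def by blast
  moreover have "w = map (g \<circ> \<omega>') [0..<l]"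
    using \<omega>'(2) by simp
  ultimately show "w \<in> prefixes l (component_seqs V E g D)"
    unfolding prefixes_def component_seqs_def by blast
qed

lemma prefixes_subset_inner_words:
  "prefixes l (component_seqs V E g D) \<subseteq> (\<Union>u\<in>D. inner_words E D g l u)"
proof
  fix w assume "w \<in> prefixes l (component_seqs V E g D)"
  then obtain \<omega> where \<omega>: "\<omega> \<in> component_walks V E D" "w = map (g \<circ> \<omega>) [0..<l]"
    unfolding prefixes_def component_seqs_def by blast
  have step: "(\<omega> k, \<omega> (Suc k)) \<in> E \<inter> D \<times> D" for k
    using \<omega>(1) unfolding component_walks_def walks_def by blast
  have "w = map (\<lambda>k. (replicate l g ! k) (\<omega> k)) [0..<length (replicate l g)]"
    using \<omega>(2) by simp
  then have "w \<in> path_words (E \<inter> D \<times> D) (replicate l g) (\<omega> 0) (\<omega> l)"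
    using walk_in_path_words[of \<omega> "E \<inter> D \<times> D" "replicate l g", OF step] by simp
  then show "w \<in> (\<Union>u\<in>D. inner_words E D g l u)"
    using step[of 0] step[of l] unfolding inner_words_def by blast
qed

lemma finite_inner_words: "finite D \<Longrightarrow> finite (inner_words E D g l u)"
  unfolding inner_words_def using finite_E by (auto intro: finite_path_words)

context
  fixes D assumes D: "D \<in> components V E"
begin

lemma finite_component: "finite D"
  using component_subset[OF D] finite_V finite_subset by auto

lemma finite_prefixes_component: "finite (prefixes l (component_seqs V E g D))"
  by (rule finite_subset[OF prefixes_subset_inner_words])
    (auto intro: finite_inner_words finite_component)

lemma component_seqs_nonempty: "component_seqs V E g D \<noteq> {}"
proof -
  obtain u where "u \<in> D"
    using component_nonempty[OF D] by blast
  then obtain \<omega> where "\<And>k. (\<omega> k, \<omega> (Suc k)) \<in> E \<inter> D \<times> D"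
    using component_walk_exists[OF D] by metis
  then have "\<omega> \<in> component_walks V E D"
    using component_subset[OF D] unfolding component_walks_def walks_def by blast
  then show ?thesis
    unfolding component_seqs_def by blast
qed

lemma shift_component_seqs: "shift ` component_seqs V E g D \<subseteq> component_seqs V E g D"
proof
  fix y assume "y \<in> shift ` component_seqs V E g D"
  then obtain \<omega> where \<omega>: "\<omega> \<in> component_walks V E D" "y = shift (g \<circ> \<omega>)"
    unfolding component_seqs_def by blast
  have "shift \<omega> \<in> component_walks V E D"
    using \<omega>(1) unfolding component_walks_def walks_def shift_def by auto
  moreover have "y = g \<circ> shift \<omega>"
    using \<omega>(2) by (auto simp: shift_def)
  ultimately show "y \<in> component_seqs V E g D"
    unfolding component_seqs_def by blast
qed

lemmas component_htop_bounds =
  htop_bounds[OF component_seqs_nonempty shift_component_seqs finite_prefixes_component]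

end

end

section \<open>Growth of the number of words\<close>

text \<open>Pigeonhole for junctions and pairs of end vertices: a sum costs only the factor
  \<open>card A\<close> against one suitable term, which no growth rate sees.\<close>

lemma sum_le_card_times_member:
  fixes f :: "'a \<Rightarrow> nat"
  assumes "finite A" "A \<noteq> {}"
  obtains x where "x \<in> A" "sum f A \<le> card A * f x"
proof -
  have "Max (f ` A) \<in> f ` A"
    using assms by (intro Max_in) auto
  then obtain x where x: "x \<in> A" "f x = Max (f ` A)"
    by auto
  have "sum f A \<le> card A * f x"
    using sum_bounded_above[of A f "f x"] x(2) assms by auto
  with x(1) show ?thesis using that by blast
qed

lemma uniform_constant:
  fixes f g :: "'a \<Rightarrow> nat \<Rightarrow> real"
  assumes "finite A" "\<And>a. a \<in> A \<Longrightarrow> \<exists>K>0. \<forall>l. f a l \<le> K * g a l"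
    and "\<And>a l. 0 \<le> g a l"
  shows "\<exists>K>0. \<forall>a\<in>A. \<forall>l. f a l \<le> K * g a l"
  using assms(1,2)
proof (induction A rule: finite_induct)
  case empty
  show ?case by (intro exI[of _ 1]) auto
next
  case (insert a A)
  obtain K where K: "K > 0" "\<And>b l. b \<in> A \<Longrightarrow> f b l \<le> K * g b l"
    using insert by auto
  obtain K' where K': "K' > 0" "\<And>l. f a l \<le> K' * g a l"
    using insert.prems by blast
  have "K * g b l \<le> max K K' * g b l" "K' * g b l \<le> max K K' * g b l" for b l
    using assms(3) by (auto intro!: mult_right_mono)
  then have "\<forall>b\<in>insert a A. \<forall>l. f b l \<le> max K K' * g b l"
    using K(2) K'(2) by (metis insertE order_trans)
  then show ?case
    using K(1) by (intro exI[of _ "max K K'"]) auto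
qed

context finite_digraph
begin

lemma reachable_subset: "u \<in> V \<Longrightarrow> E\<^sup>* `` {u} \<subseteq> V"
  using trancl_subset_Sigma[OF E_sub] by (auto simp: rtrancl_eq_or_trancl)

text \<open>The class of \<open>u\<close> is either a component, where entropy controls the count,
  or a single vertex without a loop, where only the empty word occurs.\<close>

lemma inner_words_growth:
  assumes "u \<in> V" "0 \<le> H" "0 < \<epsilon>"
    and "(u, u) \<in> E\<^sup>+ \<Longrightarrow> htop (component_seqs V E g (mutual_class E u)) \<le> H"
  shows "\<exists>K>0. \<forall>l. real (card (inner_words E (mutual_class E u) g l u)) \<le> K * exp ((H + \<epsilon>) * real l)"
proof (cases "(u, u) \<in> E\<^sup>+")
  case True
  define D where "D = mutual_class E u"
  have D: "D \<in> components V E" "u \<in> D"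
    using mutual_class_component[OF True] by (auto simp: D_def mutual_class_def)
  obtain K where K: "K > 0" "\<And>N. real (card (prefixes N (component_seqs V E g D)))
      \<le> K * exp ((htop (component_seqs V E g D) + \<epsilon>) * real N)"
    using component_htop_bounds(3)[OF D(1) assms(3)] by blast
  have "real (card (inner_words E D g l u)) \<le> K * exp ((H + \<epsilon>) * real l)" for l
  proof -
    have "card (inner_words E D g l u) \<le> card (prefixes l (component_seqs V E g D))"
      by (intro card_mono finite_prefixes_component D inner_words_subset_prefixes)
    also have "real \<dots> \<le> K * exp ((htop (component_seqs V E g D) + \<epsilon>) * real l)"
      by (rule K(2))
    also have "\<dots> \<le> K * exp ((H + \<epsilon>) * real l)"
      using K(1) assms(4)[OF True] by (auto simp: D_def intro!: mult_left_mono mult_right_mono)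
    finally show ?thesis by simp
  qed
  with K(1) show ?thesis by (auto simp: D_def)
next
  case False
  have "real (card (inner_words E (mutual_class E u) g l u)) \<le> 1 * exp ((H + \<epsilon>) * real l)" for l
  proof (cases l)
    case 0
    then have "inner_words E (mutual_class E u) g l u \<subseteq> {[]}"
      by (auto simp: inner_words_def split: if_splits)
    then have "card (inner_words E (mutual_class E u) g l u) \<le> 1"
      by (metis card.empty card_insert_le_m1 card_mono finite.emptyI finite.insertI le_numeral_extra(4)
          is_singletonI is_singleton_altdef)
    with 0 show ?thesis by simp
  next
    case (Suc k)
    have "inner_words E (mutual_class E u) g l u = {}"
      using False unfolding Suc inner_words_def
      by (auto simp: mutual_class_def intro: rtrancl_into_trancl2)
    then show ?thesis by simp
  qed
  then show ?thesis
    by (intro exI[of _ 1]) auto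
qed

lemma card_path_words_leave:
  fixes g :: "'v \<Rightarrow> 'b"
  assumes "u \<in> D" "finite D"
  defines "X \<equiv> {u'. u' \<notin> D \<and> (\<exists>x\<in>D. (x, u') \<in> E)}"
  shows "card (path_words E (replicate l g) u v) \<le> card (inner_words E D g l u) +
    (\<Sum>j<l. \<Sum>u'\<in>X. card (inner_words E D g j u) * card D *
      card (path_words E (replicate (l - Suc j) g) u' v))"
proof -
  \<comment> \<open>The three parts of a split word vary independently; the letter read at the exit
    vertex takes at most \<open>card D\<close> values, hence that factor.\<close>
  define B where "B j u' = (\<lambda>((a, b), c). a @ b # c) `
    ((inner_words E D g j u \<times> g ` D) \<times> path_words E (replicate (l - Suc j) g) u' v)" for j u'
  have fin_X: "finite X"
    by (rule finite_subset[OF _ finite_V]) (use E_sub in \<open>auto simp: X_def\<close>)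
  have fin_B: "finite (B j u')" for j u'
    unfolding B_def using assms(2) finite_E
    by (intro finite_imageI finite_cartesian_product finite_inner_words finite_path_words)
  have card_B: "card (B j u') \<le> card (inner_words E D g j u) * card D *
      card (path_words E (replicate (l - Suc j) g) u' v)" for j u'
  proof -
    have "card (B j u') \<le> card ((inner_words E D g j u \<times> g ` D) \<times> path_words E (replicate (l - Suc j) g) u' v)"
      unfolding B_def using assms(2) finite_E
      by (intro card_image_le finite_imageI finite_cartesian_product finite_inner_words finite_path_words)
    also have "\<dots> \<le> card (inner_words E D g j u) * card D *
      card (path_words E (replicate (l - Suc j) g) u' v)"
      using assms(2) by (auto simp: card_cartesian_product intro!: card_image_le)
    finally show ?thesis .
  qed
  have "path_words E (replicate l g) u v \<subseteq> inner_words E D g l u \<union> (\<Union>j<l. \<Union>u'\<in>X. B j u')"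
  proof
    fix w assume "w \<in> path_words E (replicate l g) u v"
    from path_words_leave[OF this assms(1)]
    show "w \<in> inner_words E D g l u \<union> (\<Union>j<l. \<Union>u'\<in>X. B j u')"
    proof (elim disjE exE bexE conjE)
      fix j x u' a b
      assume *: "j < l" "x \<in> D" "u' \<notin> D" "(x, u') \<in> E" "w = a @ g x # b"
        "a \<in> inner_words E D g j u" "b \<in> path_words E (replicate (l - Suc j) g) u' v"
      then have "((a, g x), b) \<in> (inner_words E D g j u \<times> g ` D) \<times> path_words E (replicate (l - Suc j) g) u' v"
        by auto
      then have "w \<in> B j u'"
        unfolding B_def by (rule rev_image_eqI) (simp add: *)
      moreover have "u' \<in> X"
        using * by (auto simp: X_def)
      ultimately show ?thesis
        using *(1) by blast
    qed auto
  qed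
  then have "card (path_words E (replicate l g) u v) \<le> card (inner_words E D g l u \<union> (\<Union>j<l. \<Union>u'\<in>X. B j u'))"
    using fin_X fin_B assms(2) by (intro card_mono) (auto intro: finite_inner_words)
  also have "\<dots> \<le> card (inner_words E D g l u) + card (\<Union>j<l. \<Union>u'\<in>X. B j u')"
    by (rule card_Un_le)
  also have "card (\<Union>j<l. \<Union>u'\<in>X. B j u') \<le> (\<Sum>j<l. card (\<Union>u'\<in>X. B j u'))"
    by (rule card_UN_le) simp
  also have "\<dots> \<le> (\<Sum>j<l. \<Sum>u'\<in>X. card (B j u'))"
    by (intro sum_mono card_UN_le fin_X)
  also have "\<dots> \<le> (\<Sum>j<l. \<Sum>u'\<in>X. card (inner_words E D g j u) * card D *
      card (path_words E (replicate (l - Suc j) g) u' v))"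
    by (intro sum_mono card_B)
  finally show ?thesis by simp
qed

text \<open>Every exit from the class of the start vertex strictly shrinks the set of reachable
  vertices, so induction on its size works. The exit decomposition is a convolution of two
  exponentials of the same rate, which costs a factor \<open>l\<close>; a spare part of \<epsilon>
  pays for it.\<close>

lemma path_words_growth:
  fixes g :: "'v \<Rightarrow> 'b"
  assumes "u \<in> V" "0 \<le> H" "0 < \<epsilon>"
    and "\<And>D x. D \<in> components V E \<Longrightarrow> x \<in> D \<Longrightarrow> (u, x) \<in> E\<^sup>* \<Longrightarrow> (x, v) \<in> E\<^sup>* \<Longrightarrow>
      htop (component_seqs V E g D) \<le> H"
  shows "\<exists>K>0. \<forall>l. real (card (path_words E (replicate l g) u v)) \<le> K * exp ((H + \<epsilon>) * real l)"
  using assms(1,3,4)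
proof (induction "card (E\<^sup>* `` {u})" arbitrary: u \<epsilon> rule: less_induct)
  case less
  show ?case
  proof (cases "(u, v) \<in> E\<^sup>*")
    case False
    then have "path_words E (replicate l g) u v = {}" for l
      using path_words_nonempty_iff[of E "replicate l g" u v] relpow_imp_rtrancl[of "(u, v)" l E] by auto
    then show ?thesis
      by (intro exI[of _ 1]) auto
  next
    case True
    define D where "D = mutual_class E u"
    define X where "X = {u'. u' \<notin> D \<and> (\<exists>x\<in>D. (x, u') \<in> E)}"
    \<comment> \<open>One \<eta> goes into the rate of both factors of the convolution, the other
      absorbs the number of exit times.\<close>
    define \<eta> where "\<eta> = \<epsilon> / 2"
    have \<eta>: "0 < \<eta>" "\<epsilon> = \<eta> + \<eta>"
      using less.prems(2) by (auto simp: \<eta>_def)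
    have u_D: "u \<in> D"
      by (auto simp: D_def mutual_class_def)
    have "D \<subseteq> V"
      using reachable_subset[OF less.prems(1)] by (auto simp: D_def mutual_class_def)
    then have fin_D: "finite D"
      using finite_V finite_subset by auto
    have X_V: "X \<subseteq> V"
      using E_sub by (auto simp: X_def)
    then have fin_X: "finite X"
      using finite_V finite_subset by auto
    have "htop (component_seqs V E g D) \<le> H" if "(u, u) \<in> E\<^sup>+"
      using less.prems(3)[OF mutual_class_component[OF that], of u] u_D True by (auto simp: D_def)
    then obtain K1 where K1: "K1 > 0" "\<And>l. real (card (inner_words E D g l u)) \<le> K1 * exp ((H + \<eta>) * real l)"
      using inner_words_growth[OF less.prems(1) assms(2) \<eta>(1)] unfolding D_def by blast
    have "\<exists>K>0. \<forall>u'\<in>X. \<forall>l. real (card (path_words E (replicate l g) u' v)) \<le> K * exp ((H + \<eta>) * real l)"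
    proof (rule uniform_constant[OF fin_X])
      fix u' assume "u' \<in> X"
      then have u': "(u, u') \<in> E\<^sup>*" "(u', u) \<notin> E\<^sup>*" "u' \<in> V"
        using X_V by (auto simp: X_def D_def mutual_class_def intro: rtrancl_into_rtrancl)
      \<comment> \<open>The vertex \<open>u\<close> itself is lost: it cannot be reached again from
        outside its class.\<close>
      have "E\<^sup>* `` {u'} \<subset> E\<^sup>* `` {u}"
        using u' by (auto intro: rtrancl_trans)
      then have "card (E\<^sup>* `` {u'}) < card (E\<^sup>* `` {u})"
        using finite_subset[OF reachable_subset[OF less.prems(1)] finite_V] by (intro psubset_card_mono)
      moreover have "htop (component_seqs V E g D') \<le> H"
        if "D' \<in> components V E" "x \<in> D'" "(u', x) \<in> E\<^sup>*" "(x, v) \<in> E\<^sup>*" for D' x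
        using less.prems(3)[OF that(1,2) _ that(4)] u'(1) that(3) by (auto intro: rtrancl_trans)
      ultimately show "\<exists>K>0. \<forall>l. real (card (path_words E (replicate l g) u' v)) \<le> K * exp ((H + \<eta>) * real l)"
        using less.hyps u'(3) \<eta>(1) by blast
    qed auto
    then obtain K2 where K2: "K2 > 0" "\<And>u' l. u' \<in> X \<Longrightarrow>
        real (card (path_words E (replicate l g) u' v)) \<le> K2 * exp ((H + \<eta>) * real l)"
      by blast
    \<comment> \<open>The constant of one exit term, summed over the exit vertices; the sum over
      exit times supplies the remaining factor \<open>l\<close>.\<close>
    define c where "c = K1 * real (card D) * K2 * real (card X)"
    have c: "0 \<le> c"
      using K1(1) K2(1) by (simp add: c_def)
    have "real (card (path_words E (replicate l g) u v)) \<le> (K1 + c / \<eta>) * exp ((H + \<epsilon>) * real l)" for l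
    proof -
      let ?e = "exp ((H + \<eta>) * real l)"
      have term_le: "real (card (inner_words E D g j u) * card D *
          card (path_words E (replicate (l - Suc j) g) u' v)) \<le> K1 * real (card D) * K2 * ?e"
        if "j < l" "u' \<in> X" for j u'
      proof -
        have "real (card (inner_words E D g j u) * card D * card (path_words E (replicate (l - Suc j) g) u' v))
            \<le> (K1 * exp ((H + \<eta>) * real j)) * real (card D) * (K2 * exp ((H + \<eta>) * real (l - Suc j)))"
          unfolding of_nat_mult using K1 K2(1) K2(2)[OF that(2)] by (intro mult_mono) auto
        also have "\<dots> = K1 * real (card D) * K2 * exp ((H + \<eta>) * real (j + (l - Suc j)))"
          by (simp add: algebra_simps exp_add)
        also have "\<dots> \<le> K1 * real (card D) * K2 * ?e"
        proof -
          have "(H + \<eta>) * real (j + (l - Suc j)) \<le> (H + \<eta>) * real l"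
            using that assms(2) \<eta>(1) by (intro mult_left_mono of_nat_mono) auto
          then show ?thesis
            using K1(1) K2(1) by (intro mult_left_mono) auto
        qed
        finally show ?thesis .
      qed
      have "real (card (path_words E (replicate l g) u v)) \<le> real (card (inner_words E D g l u)) +
          (\<Sum>j<l. \<Sum>u'\<in>X. real (card (inner_words E D g j u) * card D *
            card (path_words E (replicate (l - Suc j) g) u' v)))"
        using of_nat_mono[where 'a = real, OF card_path_words_leave[OF u_D fin_D, where l = l and v = v and g = g]]
        unfolding X_def of_nat_add of_nat_sum .
      also have "\<dots> \<le> K1 * ?e + (\<Sum>j<l. \<Sum>u'\<in>X. K1 * real (card D) * K2 * ?e)"
        by (intro add_mono sum_mono K1(2) term_le) auto
      also have "\<dots> = K1 * ?e + c * (real l * ?e)"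
        by (simp add: c_def)
      also have "\<dots> \<le> K1 * exp ((H + \<epsilon>) * real l) + c * (exp ((H + \<epsilon>) * real l) / \<eta>)"
      proof (intro add_mono mult_left_mono c)
        show "?e \<le> exp ((H + \<epsilon>) * real l)"
          using \<eta> by (auto intro!: mult_right_mono)
        \<comment> \<open>From y + 1 \<le> exp y at y = \<eta> l: the linear factor becomes an
          exponential of rate \<eta>, at the price of 1 / \<eta> in the constant.\<close>
        have "real l * \<eta> \<le> exp (\<eta> * real l)"
          using exp_ge_add_one_self[of "\<eta> * real l"] unfolding mult.commute[of "real l"] by linarith
        then have "real l * \<eta> * ?e \<le> exp (\<eta> * real l) * ?e"
          by (intro mult_right_mono) auto
        also have "\<dots> = exp ((H + \<epsilon>) * real l)"
          by (simp add: \<eta>(2) algebra_simps flip: exp_add)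
        finally show "real l * ?e \<le> exp ((H + \<epsilon>) * real l) / \<eta>"
          using \<eta>(1) by (simp add: field_simps)
      qed (use K1(1) in auto)
      also have "\<dots> = (K1 + c / \<eta>) * exp ((H + \<epsilon>) * real l)"
        by (simp add: field_simps)
      finally show ?thesis .
    qed
    moreover have "0 < K1 + c / \<eta>"
      using K1(1) c \<eta>(1) by (simp add: add_pos_nonneg)
    ultimately show ?thesis by blast
  qed
qed

text \<open>Away from cycles no vertex can be revisited, so each step drops at least one vertex from
  the reachable set.\<close>

lemma acyclic_path_short:
  assumes "(u, v) \<in> E ^^ l" "\<And>x. (u, x) \<in> E\<^sup>* \<Longrightarrow> (x, v) \<in> E\<^sup>* \<Longrightarrow> (x, x) \<notin> E\<^sup>+" "u \<in> V"
  shows "l < card (E\<^sup>* `` {u})"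
  using assms
proof (induction l arbitrary: u)
  case 0
  have "finite (E\<^sup>* `` {u})"
    using finite_subset[OF reachable_subset[OF 0(3)] finite_V] .
  then show ?case by (auto simp: card_gt_0_iff)
next
  case (Suc l)
  then obtain u' where u': "(u, u') \<in> E" "(u', v) \<in> E ^^ l"
    by (meson relpow_Suc_E2)
  have v: "(u', v) \<in> E\<^sup>*"
    using u'(2) by (rule relpow_imp_rtrancl)
  have l: "l < card (E\<^sup>* `` {u'})"
    using u' Suc.prems(2) E_sub by (intro Suc.IH) (auto intro: converse_rtrancl_into_rtrancl)
  have "(u', u) \<notin> E\<^sup>*"
    using Suc.prems(2)[of u] u'(1) v by (auto intro: rtrancl_into_trancl2 converse_rtrancl_into_rtrancl)
  then have "E\<^sup>* `` {u'} \<subset> E\<^sup>* `` {u}"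
    using u'(1) by (auto intro: converse_rtrancl_into_rtrancl)
  then have "card (E\<^sup>* `` {u'}) < card (E\<^sup>* `` {u})"
    using finite_subset[OF reachable_subset[OF Suc.prems(3)] finite_V] by (intro psubset_card_mono)
  with l show ?case by simp
qed

text \<open>Supplies the component that a long segment has to name in the upper estimate.\<close>

lemma long_path_meets_component:
  assumes "(u, v) \<in> E ^^ l" "card V \<le> l" "u \<in> V"
  obtains D x where "D \<in> components V E" "x \<in> D" "(u, x) \<in> E\<^sup>*" "(x, v) \<in> E\<^sup>*"
proof -
  have "card (E\<^sup>* `` {u}) \<le> card V"
    by (intro card_mono finite_V reachable_subset assms(3))
  then obtain x where "(u, x) \<in> E\<^sup>*" "(x, v) \<in> E\<^sup>*" "(x, x) \<in> E\<^sup>+"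
    using acyclic_path_short[OF assms(1) _ assms(3)] assms(2) by fastforce
  then show ?thesis
    using that[OF mutual_class_component, of x x] by (auto simp: mutual_class_def)
qed

text \<open>Between fixed ends the fastest component met on the way governs the count. The length
  condition excludes short paths through transient vertices only, for which no \<open>D\<close>
  could be named.\<close>

lemma segment_upper:
  fixes g :: "'v \<Rightarrow> 'b"
  assumes "0 < \<epsilon>"
  shows "\<exists>K>0. \<forall>u\<in>V. \<forall>v\<in>V. \<forall>l\<ge>card V. path_words E (replicate l g) u v \<noteq> {} \<longrightarrow>
    (\<exists>D\<in>components V E. (\<exists>x\<in>D. (u, x) \<in> E\<^sup>* \<and> (x, v) \<in> E\<^sup>*) \<and>
      real (card (path_words E (replicate l g) u v)) \<le> K * exp ((htop (component_seqs V E g D) + \<epsilon>) * real l))"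
proof -
  define BD where "BD = (\<lambda>(u, v). {D \<in> components V E. \<exists>x\<in>D. (u, x) \<in> E\<^sup>* \<and> (x, v) \<in> E\<^sup>*})"
  define h where "h D = htop (component_seqs V E g D)" for D
  \<comment> \<open>The value 0 serves pairs of ends with no component between them; at lengths from
    \<open>card V\<close> on, such pairs have no words to count.\<close>
  define H where "H p = (if BD p = {} then 0 else Max (h ` BD p))" for p
  have fin: "finite (BD p)" for p
    using finite_components by (cases p) (auto simp: BD_def)
  have h_le: "h D \<le> H p" if "D \<in> BD p" for D p
    using that fin[of p] by (auto simp: H_def)
  have h_nonneg: "0 \<le> h D" if "D \<in> components V E" for D
    unfolding h_def by (rule component_htop_bounds(1)[OF that])
  have H_nonneg: "0 \<le> H p" for p
  proof (cases "BD p = {}")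
    case False
    then obtain D where D: "D \<in> BD p" by blast
    then have "D \<in> components V E"
      by (cases p) (auto simp: BD_def)
    from h_nonneg[OF this] h_le[OF D] show ?thesis by simp
  qed (simp add: H_def)
  have "\<exists>K>0. \<forall>p\<in>V \<times> V. \<forall>l. real (card (path_words E (replicate l g) (fst p) (snd p)))
      \<le> K * exp ((H p + \<epsilon>) * real l)"
  proof (rule uniform_constant)
    fix p assume "p \<in> V \<times> V"
    moreover have "htop (component_seqs V E g D) \<le> H p"
      if "D \<in> components V E" "x \<in> D" "(fst p, x) \<in> E\<^sup>*" "(x, snd p) \<in> E\<^sup>*" for D x
      using h_le[of D p] that unfolding h_def BD_def by (cases p) auto
    ultimately show "\<exists>K>0. \<forall>l. real (card (path_words E (replicate l g) (fst p) (snd p)))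
      \<le> K * exp ((H p + \<epsilon>) * real l)"
      by (intro path_words_growth H_nonneg assms) auto
  qed (use finite_V in auto)
  then obtain K where K: "K > 0" "\<And>u v l. u \<in> V \<Longrightarrow> v \<in> V \<Longrightarrow>
      real (card (path_words E (replicate l g) u v)) \<le> K * exp ((H (u, v) + \<epsilon>) * real l)"
    by auto
  have "\<exists>D\<in>components V E. (\<exists>x\<in>D. (u, x) \<in> E\<^sup>* \<and> (x, v) \<in> E\<^sup>*) \<and>
      real (card (path_words E (replicate l g) u v)) \<le> K * exp ((htop (component_seqs V E g D) + \<epsilon>) * real l)"
    if "u \<in> V" "v \<in> V" "card V \<le> l" "path_words E (replicate l g) u v \<noteq> {}" for u v l
  proof -
    have "(u, v) \<in> E ^^ l"
      using that(4) unfolding path_words_nonempty_iff by simp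
    then obtain D x where "D \<in> components V E" "x \<in> D" "(u, x) \<in> E\<^sup>*" "(x, v) \<in> E\<^sup>*"
      using long_path_meets_component[OF _ \<open>card V \<le> l\<close> \<open>u \<in> V\<close>] by metis
    then have ne: "BD (u, v) \<noteq> {}"
      by (auto simp: BD_def)
    then have "H (u, v) \<in> h ` BD (u, v)"
      using fin[of "(u, v)"] Max_in[of "h ` BD (u, v)"] by (simp add: H_def)
    then obtain D where "D \<in> BD (u, v)" "h D = H (u, v)" by auto
    then show ?thesis
      using K(2)[OF that(1,2), of l] by (auto simp: BD_def h_def)
  qed
  with K(1) show ?thesis by blast
qed

text \<open>The last vertex is left free: prescribing it could contradict the period of the component.\<close>

lemma segment_lower:
  fixes g :: "'v \<Rightarrow> 'b"
  assumes D: "D \<in> components V E"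
  shows "\<exists>c>0. \<forall>u. \<forall>x\<in>D. \<forall>l\<ge>card E. (u, x) \<in> E\<^sup>* \<longrightarrow>
    (\<exists>v\<in>D. c * exp (htop (component_seqs V E g D) * real l) \<le> real (card (path_words E (replicate l g) u v)))"
proof -
  define h where "h = htop (component_seqs V E g D)"
  \<comment> \<open>Every reachable vertex is reached within \<open>card E\<close> steps; this is
    the time reserved for entering \<open>D\<close>.\<close>
  define B where "B = card E"
  \<comment> \<open>The two losses: \<open>B\<close> letters at rate \<open>h\<close>, and the
    pigeonhole over the ends of the middle part.\<close>
  define c where "c = exp (- (h * real B)) / real (card (D \<times> D))"
  have fin: "finite D" "finite (D \<times> D)" "D \<times> D \<noteq> {}"
    using finite_component[OF D] component_nonempty[OF D] by auto
  then have card_pos: "0 < card (D \<times> D)"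
    by (metis card_gt_0_iff)
  have "\<exists>v\<in>D. c * exp (h * real l) \<le> real (card (path_words E (replicate l g) u v))"
    if x: "x \<in> D" "(u, x) \<in> E\<^sup>*" and l: "B \<le> l" for u x l
  proof -
    \<comment> \<open>Only \<open>l - B\<close> letters are counted inside \<open>D\<close>. Of the
      other \<open>B\<close> letters, \<open>b\<close> are spent on reaching \<open>p\<close>, and
      \<open>B - b\<close> are filled by walking on in \<open>D\<close> from \<open>q\<close>, so
      the total length is \<open>l\<close> whatever \<open>b\<close> is.\<close>
    define W where "W = (\<lambda>(p, q). path_words (E \<inter> D \<times> D) (replicate (l - B) g) p q)"
    obtain pq where pq: "pq \<in> D \<times> D" "(\<Sum>pq\<in>D \<times> D. card (W pq)) \<le> card (D \<times> D) * card (W pq)"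
      using sum_le_card_times_member[OF fin(2,3), of "\<lambda>pq. card (W pq)"] by blast
    obtain p q where pq_eq: "pq = (p, q)" by (cases pq)
    have fin_W: "finite (W r)" for r
      using finite_E by (cases r) (auto simp: W_def intro: finite_path_words)
    have "prefixes (l - B) (component_seqs V E g D) \<subseteq> (\<Union>pq\<in>D \<times> D. W pq)"
      using prefixes_subset_inner_words[of "l - B" g D] by (auto simp: W_def inner_words_def)
    then have "card (prefixes (l - B) (component_seqs V E g D)) \<le> card (\<Union>pq\<in>D \<times> D. W pq)"
      using fin fin_W by (intro card_mono) auto
    also have "\<dots> \<le> (\<Sum>pq\<in>D \<times> D. card (W pq))"
      by (rule card_UN_le) fact
    also note pq(2)
    also have "card (W pq) \<le> card (path_words E (replicate (l - B) g) p q)"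
      unfolding W_def pq_eq prod.case
      by (intro card_mono finite_path_words finite_E path_words_mono) auto
    finally have count: "card (prefixes (l - B) (component_seqs V E g D))
        \<le> card (D \<times> D) * card (path_words E (replicate (l - B) g) p q)"
      by simp
    have "(u, p) \<in> E\<^sup>*"
      using x component_strongly_connected[OF D x(1), of p] pq(1) pq_eq
      by (auto intro: rtrancl_trans trancl_into_rtrancl)
    then obtain b where b: "b \<le> B" "(u, p) \<in> E ^^ b"
      using rtrancl_finite_eq_relpow[OF finite_E] by (auto simp: B_def)
    obtain \<omega> where \<omega>: "\<omega> 0 = q" "\<And>k. (\<omega> k, \<omega> (Suc k)) \<in> E \<inter> D \<times> D"
      using component_walk_exists[OF D, of q] pq(1) pq_eq by blast
    define v where "v = \<omega> (B - b)"
    have "path_words E (replicate (B - b) g) q v \<noteq> {}"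
      using walk_in_path_words[of \<omega> E "replicate (B - b) g"] \<omega> by (auto simp: v_def)
    then have "1 \<le> card (path_words E (replicate (B - b) g) q v)"
      by (simp add: Suc_le_eq card_gt_0_iff finite_path_words finite_E)
    moreover have "path_words E (replicate b g) u p \<noteq> {}"
      using b(2) by (simp add: path_words_nonempty_iff)
    then have "1 \<le> card (path_words E (replicate b g) u p)"
      by (simp add: Suc_le_eq card_gt_0_iff finite_path_words finite_E)
    ultimately have "1 * card (path_words E (replicate (l - B) g) p q) * 1 \<le>
        card (path_words E (replicate b g) u p) * card (path_words E (replicate (l - B) g) p q) *
        card (path_words E (replicate (B - b) g) q v)"
      by (intro mult_mono) auto
    also have "\<dots> \<le> card (path_words E (replicate b g @ replicate (l - B) g) u q) *
        card (path_words E (replicate (B - b) g) q v)"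
      by (intro mult_right_mono card_path_words_append_ge finite_E) auto
    also have "\<dots> \<le> card (path_words E ((replicate b g @ replicate (l - B) g) @ replicate (B - b) g) u v)"
      by (intro card_path_words_append_ge finite_E)
    also have "(replicate b g @ replicate (l - B) g) @ replicate (B - b) g = replicate l g"
      using b(1) l by (simp flip: replicate_add)
    finally have long: "card (path_words E (replicate (l - B) g) p q) \<le> card (path_words E (replicate l g) u v)"
      by simp
    have "exp (- (h * real B)) * exp (h * real l) = exp (h * real (l - B))"
      using l by (simp add: algebra_simps of_nat_diff flip: exp_add)
    also have "\<dots> \<le> real (card (prefixes (l - B) (component_seqs V E g D)))"
      unfolding h_def by (rule component_htop_bounds(2)[OF D])
    also have "\<dots> \<le> real (card (D \<times> D) * card (path_words E (replicate l g) u v))"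
      using count long by (intro of_nat_mono) (meson le_trans mult_le_mono2)
    finally have "c * exp (h * real l) \<le> real (card (path_words E (replicate l g) u v))"
      using card_pos by (simp only: c_def of_nat_mult) (simp add: field_simps)
    moreover have "v \<in> D"
      using \<omega>(2)[of "B - b"] by (simp add: v_def)
    ultimately show ?thesis by blast
  qed
  moreover have "0 < c"
    using card_pos by (simp only: c_def) simp
  ultimately show ?thesis
    unfolding h_def B_def by blast
qed

end

section \<open>Component chains\<close>

primrec block_labels :: "(nat \<Rightarrow> 'c) \<Rightarrow> (nat \<Rightarrow> nat) \<Rightarrow> nat \<Rightarrow> 'c list" where
  "block_labels g l 0 = []"
| "block_labels g l (Suc j) = block_labels g l j @ replicate (l (Suc j)) (g (Suc j))"

context finite_digraph
begin

lemma chain_components: "D \<in> component_chains V E r \<Longrightarrow> i \<in> {1..r} \<Longrightarrow> D i \<in> components V E"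
  unfolding component_chains_def by auto

lemma finite_component_chains: "finite (component_chains V E r)"
  by (rule finite_subset[of _ "{1..r} \<rightarrow>\<^sub>E components V E"])
    (auto simp: component_chains_def intro: finite_PiE finite_components)

text \<open>A walk followed for \<open>card V\<close> steps supplies a component, and the constant
  chain suffices. This makes the maximum over chains meaningful.\<close>

lemma component_chains_nonempty:
  assumes "walks V E \<noteq> {}"
  shows "component_chains V E r \<noteq> {}"
proof -
  obtain \<omega> where \<omega>: "\<And>k. \<omega> k \<in> V" "\<And>k. (\<omega> k, \<omega> (Suc k)) \<in> E"
    using assms unfolding walks_def by auto
  have "(\<omega> 0, \<omega> k) \<in> E ^^ k" for k
    by (induction k) (use \<omega> in auto)
  then obtain D where "D \<in> components V E"
    using long_path_meets_component[OF _ order_refl \<omega>(1)] by metis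
  then have "restrict (\<lambda>_. D) {1..r} \<in> component_chains V E r"
    by (auto simp: component_chains_def)
  then show ?thesis by blast
qed

text \<open>Segments are glued at their free ends: strong connectivity lets the next segment start
  from whatever vertex of the component the previous one ended in.\<close>

lemma chain_lower:
  fixes g :: "nat \<Rightarrow> 'v \<Rightarrow> 'b"
  assumes D: "D \<in> component_chains V E s" and "1 \<le> s"
  shows "\<exists>c>0. \<forall>l. (\<forall>i\<in>{1..s}. card E \<le> l i) \<longrightarrow> (\<exists>u\<in>V. \<exists>v\<in>D s.
    c * exp (\<Sum>i = 1..s. htop (component_seqs V E (g i) (D i)) * real (l i)) \<le>
      real (card (path_words E (block_labels g l s) u v)))"
proof -
  define h where "h i = htop (component_seqs V E (g i) (D i))" for i
  have comp: "D i \<in> components V E" if "i \<in> {1..s}" for i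
    using chain_components[OF D that] .
  obtain u where u: "u \<in> D 1"
    using component_nonempty[OF comp[of 1]] \<open>1 \<le> s\<close> by auto
  \<comment> \<open>At \<open>j = 0\<close> nothing is read and the end is \<open>u\<close> itself,
    which already lies in \<open>D 1\<close>; hence \<open>max 1 j\<close>.\<close>
  have "\<exists>c>0. \<forall>l. (\<forall>i\<in>{1..s}. card E \<le> l i) \<longrightarrow> (\<exists>v\<in>D (max 1 j).
    c * exp (\<Sum>i = 1..j. h i * real (l i)) \<le> real (card (path_words E (block_labels g l j) u v)))"
    if "j \<le> s" for j
    using that
  proof (induction j)
    case 0
    show ?case
      using u by (intro exI[of _ 1]) auto
  next
    case (Suc j)
    then obtain c where c: "0 < c" "\<And>l. (\<forall>i\<in>{1..s}. card E \<le> l i) \<Longrightarrow> (\<exists>v\<in>D (max 1 j).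
        c * exp (\<Sum>i = 1..j. h i * real (l i)) \<le> real (card (path_words E (block_labels g l j) u v)))"
      by auto
    have DS: "D (Suc j) \<in> components V E"
      using comp Suc.prems by simp
    obtain c' where c': "0 < c'" "\<And>w x l. x \<in> D (Suc j) \<Longrightarrow> card E \<le> l \<Longrightarrow> (w, x) \<in> E\<^sup>* \<Longrightarrow>
        \<exists>v\<in>D (Suc j). c' * exp (h (Suc j) * real l) \<le>
          real (card (path_words E (replicate l (g (Suc j))) w v))"
      using segment_lower[OF DS, of "g (Suc j)"] unfolding h_def by blast
    have "\<exists>v\<in>D (max 1 (Suc j)). c * c' * exp (\<Sum>i = 1..Suc j. h i * real (l i)) \<le>
        real (card (path_words E (block_labels g l (Suc j)) u v))"
      if l: "\<forall>i\<in>{1..s}. card E \<le> l i" for l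
    proof -
      obtain w where w: "w \<in> D (max 1 j)"
        "c * exp (\<Sum>i = 1..j. h i * real (l i)) \<le> real (card (path_words E (block_labels g l j) u w))"
        using c(2)[OF l] by blast
      have "\<exists>x\<in>D (Suc j). (w, x) \<in> E\<^sup>*"
      proof (cases "j = 0 \<or> D j = D (j + 1)")
        case True
        then show ?thesis
          using w(1) by (cases "j = 0") auto
      next
        case False
        then have "1 \<le> j" "j < s"
          using Suc.prems by auto
        then obtain y z where "y \<in> D j" "z \<in> D (j + 1)" "(y, z) \<in> E\<^sup>+"
          using D False unfolding component_chains_def by blast
        moreover have "(w, y) \<in> E\<^sup>+"
          using component_strongly_connected[OF comp[of j]] \<open>1 \<le> j\<close> \<open>j < s\<close> w(1) \<open>y \<in> D j\<close> by auto
        ultimately show ?thesis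
          by (auto intro: trancl_into_rtrancl trancl_trans)
      qed
      then obtain v where v: "v \<in> D (Suc j)" "c' * exp (h (Suc j) * real (l (Suc j))) \<le>
          real (card (path_words E (replicate (l (Suc j)) (g (Suc j))) w v))"
        using c'(2)[of _ "l (Suc j)" w] l Suc.prems by (auto; blast)
      have "c * c' * exp (\<Sum>i = 1..Suc j. h i * real (l i)) =
          (c * exp (\<Sum>i = 1..j. h i * real (l i))) * (c' * exp (h (Suc j) * real (l (Suc j))))"
        by (simp add: exp_add)
      also have "\<dots> \<le> real (card (path_words E (block_labels g l j) u w)) *
          real (card (path_words E (replicate (l (Suc j)) (g (Suc j))) w v))"
        using w(2) v(2) c(1) c'(1) by (intro mult_mono) auto
      also have "\<dots> \<le> real (card (path_words E (block_labels g l (Suc j)) u v))"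
        using card_path_words_append_ge[OF finite_E] by (simp flip: of_nat_mult)
      finally show ?thesis
        using v(1) by auto
    qed
    then show ?case
      using c(1) c'(1) by (intro exI[of _ "c * c'"]) auto
  qed
  from this[of s] obtain c where "c > 0" "\<And>l. (\<forall>i\<in>{1..s}. card E \<le> l i) \<Longrightarrow> (\<exists>v\<in>D s.
      c * exp (\<Sum>i = 1..s. h i * real (l i)) \<le> real (card (path_words E (block_labels g l s) u v)))"
    using \<open>1 \<le> s\<close> by (auto simp: max_def)
  moreover have "u \<in> V"
    using u component_subset[OF comp[of 1]] \<open>1 \<le> s\<close> by auto
  ultimately show ?thesis
    unfolding h_def by blast
qed

text \<open>The components named by two successive segments are linked by the junction between them:
  it is reached from the first and reaches the second.\<close>

lemma chain_upper:
  fixes g :: "nat \<Rightarrow> 'v \<Rightarrow> 'b"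
  assumes "0 < \<epsilon>"
  shows "\<exists>K>0. \<forall>l. (\<forall>i\<in>{1..s}. card V \<le> l i) \<longrightarrow>
    (\<forall>u\<in>V. \<forall>v\<in>V. path_words E (block_labels g l s) u v \<noteq> {} \<longrightarrow>
      (\<exists>D\<in>component_chains V E s.
        real (card (path_words E (block_labels g l s) u v)) \<le>
          K * exp (\<Sum>i = 1..s. (htop (component_seqs V E (g i) (D i)) + \<epsilon>) * real (l i))))"
proof -
  define h where "h i C = htop (component_seqs V E (g i) C) + \<epsilon>" for i C
  \<comment> \<open>Strengthened for the induction: the last component must reach the current end,
    so that the component named next extends the chain.\<close>
  have "\<exists>K>0. \<forall>l. (\<forall>i\<in>{1..j}. card V \<le> l i) \<longrightarrow>
    (\<forall>u\<in>V. \<forall>v\<in>V. path_words E (block_labels g l j) u v \<noteq> {} \<longrightarrow>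
      (\<exists>D\<in>component_chains V E j. (1 \<le> j \<longrightarrow> (\<exists>x\<in>D j. (x, v) \<in> E\<^sup>*)) \<and>
        real (card (path_words E (block_labels g l j) u v)) \<le>
          K * exp (\<Sum>i = 1..j. h i (D i) * real (l i))))" for j
  proof (induction j)
    case 0
    have "component_chains V E 0 = {\<lambda>_. undefined}"
      by (auto simp: component_chains_def)
    then show ?case
      by (intro exI[of _ 1]) auto
  next
    case (Suc j)
    obtain K where "0 < K" and K: "\<forall>l. (\<forall>i\<in>{1..j}. card V \<le> l i) \<longrightarrow>
      (\<forall>u\<in>V. \<forall>v\<in>V. path_words E (block_labels g l j) u v \<noteq> {} \<longrightarrow>
      (\<exists>D\<in>component_chains V E j. (1 \<le> j \<longrightarrow> (\<exists>x\<in>D j. (x, v) \<in> E\<^sup>*)) \<and>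
        real (card (path_words E (block_labels g l j) u v)) \<le>
          K * exp (\<Sum>i = 1..j. h i (D i) * real (l i))))"
      using Suc.IH by (elim exE conjE) (rule that)
    obtain K' where "0 < K'" and K': "\<forall>u\<in>V. \<forall>v\<in>V. \<forall>l\<ge>card V.
      path_words E (replicate l (g (Suc j))) u v \<noteq> {} \<longrightarrow>
      (\<exists>D\<in>components V E. (\<exists>x\<in>D. (u, x) \<in> E\<^sup>* \<and> (x, v) \<in> E\<^sup>*) \<and>
      real (card (path_words E (replicate l (g (Suc j))) u v)) \<le> K' * exp (h (Suc j) D * real l))"
      using segment_upper[OF assms, of "g (Suc j)"] unfolding h_def[symmetric]
      by (elim exE conjE) (rule that)
    \<comment> \<open>The pigeonhole over junctions costs \<open>card V\<close>; the summand 1 keeps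
      the constant positive even for empty \<open>V\<close>.\<close>
    have "\<exists>D\<in>component_chains V E (Suc j). (\<exists>x\<in>D (Suc j). (x, v) \<in> E\<^sup>*) \<and>
        real (card (path_words E (block_labels g l (Suc j)) u v)) \<le>
          real (card V + 1) * K * K' * exp (\<Sum>i = 1..Suc j. h i (D i) * real (l i))"
      if l: "\<forall>i\<in>{1..Suc j}. card V \<le> l i" and uv: "u \<in> V" "v \<in> V"
        and ne: "path_words E (block_labels g l (Suc j)) u v \<noteq> {}" for l u v
    proof -
      define P where "P x = path_words E (block_labels g l j) u x" for x
      define Q where "Q x = path_words E (replicate (l (Suc j)) (g (Suc j))) x v" for x
      have V_ne: "V \<noteq> {}" using uv by auto
      obtain x where x: "x \<in> V" "(\<Sum>x\<in>V. card (P x) * card (Q x)) \<le> card V * (card (P x) * card (Q x))"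
        using sum_le_card_times_member[OF finite_V V_ne] by blast
      have "card (path_words E (block_labels g l (Suc j)) u v) \<le> (\<Sum>x\<in>V. card (P x) * card (Q x))"
        unfolding P_def Q_def block_labels.simps by (rule card_path_words_append_le[OF finite_V E_sub uv(1)])
      then have count: "card (path_words E (block_labels g l (Suc j)) u v) \<le> card V * (card (P x) * card (Q x))"
        using x(2) by (rule order_trans)
      have "0 < card (path_words E (block_labels g l (Suc j)) u v)"
        using ne by (simp add: card_gt_0_iff finite_path_words finite_E del: block_labels.simps)
      then have "0 < card V * (card (P x) * card (Q x))"
        using count by linarith
      then have "P x \<noteq> {}" "Q x \<noteq> {}"
        by auto
      obtain D where D: "D \<in> component_chains V E j" "1 \<le> j \<Longrightarrow> \<exists>z\<in>D j. (z, x) \<in> E\<^sup>*"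
          "real (card (P x)) \<le> K * exp (\<Sum>i = 1..j. h i (D i) * real (l i))"
        using K[rule_format, OF _ uv(1) x(1), of l] l \<open>P x \<noteq> {}\<close> unfolding P_def
        by (metis (no_types, lifting) atLeastAtMost_iff le_SucI)
      obtain C y where C: "C \<in> components V E" "y \<in> C" "(x, y) \<in> E\<^sup>*" "(y, v) \<in> E\<^sup>*"
          "real (card (Q x)) \<le> K' * exp (h (Suc j) C * real (l (Suc j)))"
        using K'[rule_format, OF x(1) uv(2), of "l (Suc j)"] l \<open>Q x \<noteq> {}\<close> unfolding Q_def
        by (metis atLeastAtMost_iff le_add1 order_refl plus_1_eq_Suc)
      define D' where "D' = D(Suc j := C)"
      have D_PiE: "D \<in> {1..j} \<rightarrow>\<^sub>E components V E"
        using D(1) by (simp add: component_chains_def)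
      have "D' \<in> component_chains V E (Suc j)"
      proof -
        have "D' \<in> {1..Suc j} \<rightarrow>\<^sub>E components V E"
          using D_PiE C(1) by (auto simp: D'_def PiE_iff extensional_def)
        moreover have "D' k = D' (k + 1) \<or> (\<exists>u\<in>D' k. \<exists>v\<in>D' (k + 1). (u, v) \<in> E\<^sup>+)"
          if k: "1 \<le> k" "k < Suc j" for k
        proof (cases "k = j")
          case False
          with k have "k < j" by simp
          with D(1) k show ?thesis
            by (simp add: D'_def component_chains_def)
        next
          case True
          with k obtain z where z: "z \<in> D j" "(z, x) \<in> E\<^sup>*"
            using D(2) by auto
          \<comment> \<open>A cycle at \<open>z\<close> makes the connection to \<open>y\<close> a
            path of positive length, as a chain demands, even if \<open>z = y\<close>.\<close>
          have "(z, z) \<in> E\<^sup>+"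
            using component_strongly_connected[OF chain_components[OF D(1), of j] z(1) z(1)] k True by simp
          then have "(z, y) \<in> E\<^sup>+"
            using z(2) C(3) by (meson trancl_rtrancl_trancl)
          then show ?thesis
            using z(1) C(2) True by (auto simp: D'_def)
        qed
        ultimately show ?thesis
          unfolding component_chains_def by blast
      qed
      moreover have "\<exists>x\<in>D' (Suc j). (x, v) \<in> E\<^sup>*"
        using C by (auto simp: D'_def)
      moreover have "real (card (path_words E (block_labels g l (Suc j)) u v)) \<le>
          real (card V + 1) * K * K' * exp (\<Sum>i = 1..Suc j. h i (D' i) * real (l i))"
      proof -
        have "real (card (path_words E (block_labels g l (Suc j)) u v)) \<le>
            real (card V) * (real (card (P x)) * real (card (Q x)))"
          using count by (metis of_nat_le_iff of_nat_mult)
        also have "\<dots> \<le> real (card V + 1) * ((K * exp (\<Sum>i = 1..j. h i (D i) * real (l i))) *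
            (K' * exp (h (Suc j) C * real (l (Suc j)))))"
          using D(3) C(5) \<open>0 < K\<close> by (intro mult_mono) auto
        also have "(\<Sum>i = 1..j. h i (D i) * real (l i)) = (\<Sum>i = 1..j. h i (D' i) * real (l i))"
          by (intro sum.cong) (auto simp: D'_def)
        also have "real (card V + 1) * ((K * exp (\<Sum>i = 1..j. h i (D' i) * real (l i))) *
            (K' * exp (h (Suc j) C * real (l (Suc j))))) =
            real (card V + 1) * K * K' * exp (\<Sum>i = 1..Suc j. h i (D' i) * real (l i))"
          by (simp add: exp_add D'_def)
        finally show ?thesis .
      qed
      ultimately show ?thesis by blast
    qed
    then show ?case
      using \<open>0 < K\<close> \<open>0 < K'\<close> by (intro exI[of _ "real (card V + 1) * K * K'"]) auto
  qed
  from this[of s] show ?thesis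
    unfolding h_def by blast
qed

end

section \<open>Approximate squares\<close>

text \<open>The integer with base \<open>b\<close> digits y 0, ..., y (L - 1), most significant
  first. Divided by \<open>b ^ L\<close> it is the left end of the grid interval of level
  \<open>L\<close> selected by these digits.\<close>

primrec base_code :: "nat \<Rightarrow> (nat \<Rightarrow> int) \<Rightarrow> nat \<Rightarrow> int" where
  "base_code b y 0 = 0"
| "base_code b y (Suc L) = int b * base_code b y L + y L"

text \<open>Reduction modulo \<open>b\<close> recovers the last digit.\<close>

lemma base_code_eq_iff:
  assumes "\<And>k. 0 \<le> x k \<and> x k < int b" "\<And>k. 0 \<le> y k \<and> y k < int b"
  shows "base_code b x L = base_code b y L \<longleftrightarrow> (\<forall>k<L. x k = y k)"
proof (induction L)
  case (Suc L)
  have "0 < int b"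
    using assms(1)[of 0] by linarith
  have "base_code b x L = base_code b y L \<and> x L = y L"
    if eq: "base_code b x (Suc L) = base_code b y (Suc L)"
  proof -
    have "(int b * base_code b x L + x L) mod int b = (int b * base_code b y L + y L) mod int b"
      using eq by simp
    then have "x L = y L"
      using assms(1)[of L] assms(2)[of L] by simp
    then show ?thesis
      using eq \<open>0 < int b\<close> by simp
  qed
  then have "base_code b x (Suc L) = base_code b y (Suc L) \<longleftrightarrow>
      base_code b x L = base_code b y L \<and> x L = y L"
    by auto
  then show ?case
    unfolding Suc.IH by (auto simp: less_Suc_eq)
qed simp

lemma base_code_range:
  assumes "\<And>k. 0 \<le> y k \<and> y k < int b"
  shows "0 \<le> base_code b y L \<and> base_code b y L < int b ^ L"
proof (induction L)
  case (Suc L)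
  have "int b * base_code b y L + y L < int b * (base_code b y L + 1)"
    using assms[of L] by (simp add: distrib_left)
  also have "\<dots> \<le> int b * int b ^ L"
    using Suc by (intro mult_left_mono) auto
  finally show ?case
    using Suc assms[of L] by simp
qed simp

context
  fixes b :: nat and y :: "nat \<Rightarrow> int"
  assumes b: "2 \<le> b" and y: "\<And>k. 0 \<le> y k \<and> y k < int b"
begin

lemma base_code_partial_sum:
  "(\<Sum>k<L. real_of_int (y k) / real b ^ (k + 1)) = real_of_int (base_code b y L) / real b ^ L"
proof (induction L)
  case (Suc L)
  then show ?case using b by (simp add: field_simps)
qed simp

lemma summable_expansion: "summable (\<lambda>k. real_of_int (y k) / real b ^ (k + 1))"
proof (rule summable_comparison_test'[of "\<lambda>k. (1 / real b) ^ k" 0])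
  show "summable (\<lambda>k. (1 / real b) ^ k)"
    using b by (intro summable_geometric) auto
  show "norm (real_of_int (y k) / real b ^ (k + 1)) \<le> (1 / real b) ^ k" for k
  proof -
    have "real_of_int (y k) \<le> real b"
      using y[of k] by linarith
    then show ?thesis
      using y[of k] b by (simp add: field_simps)
  qed
qed

text \<open>Nested grid intervals: the left ends increase and the right ends decrease with the
  level. The right end is included because the digits may be \<open>b - 1\<close> forever.\<close>

lemma expansion_bounds:
  defines "S \<equiv> \<Sum>k. real_of_int (y k) / real b ^ (k + 1)"
  shows "real_of_int (base_code b y L) / real b ^ L \<le> S"
    and "S \<le> (real_of_int (base_code b y L) + 1) / real b ^ L"
proof -
  let ?c = "\<lambda>N. real_of_int (base_code b y N)"
  have lim: "(\<lambda>N. ?c N / real b ^ N) \<longlonglongrightarrow> S"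
    using summable_LIMSEQ[OF summable_expansion] unfolding base_code_partial_sum S_def .
  have step: "?c N / real b ^ N \<le> ?c (Suc N) / real b ^ Suc N"
    "(?c (Suc N) + 1) / real b ^ Suc N \<le> (?c N + 1) / real b ^ N" for N
  proof -
    show "?c N / real b ^ N \<le> ?c (Suc N) / real b ^ Suc N"
      using b y[of N] by (simp add: field_simps)
    have "real_of_int (y N) + 1 \<le> real b"
      using y[of N] by linarith
    then have "?c (Suc N) + 1 \<le> real b * (?c N + 1)"
      by (simp add: algebra_simps)
    then have "(?c (Suc N) + 1) / real b ^ Suc N \<le> (real b * (?c N + 1)) / real b ^ Suc N"
      by (intro divide_right_mono) auto
    also have "\<dots> = (?c N + 1) / real b ^ N"
      using b by simp
    finally show "(?c (Suc N) + 1) / real b ^ Suc N \<le> (?c N + 1) / real b ^ N" .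
  qed
  have "incseq (\<lambda>N. ?c N / real b ^ N)"
    by (intro incseq_SucI step)
  then show "?c L / real b ^ L \<le> S"
    using lim by (rule incseq_le)
  have "decseq (\<lambda>N. (?c N + 1) / real b ^ N)"
    by (intro decseq_SucI step)
  then have "?c N / real b ^ N \<le> (?c L + 1) / real b ^ L" if "L \<le> N" for N
  proof -
    have "?c N / real b ^ N \<le> (?c N + 1) / real b ^ N"
      by (intro divide_right_mono) auto
    also have "\<dots> \<le> (?c L + 1) / real b ^ L"
      using \<open>decseq _\<close> that by (rule decseqD)
    finally show ?thesis .
  qed
  then show "S \<le> (?c L + 1) / real b ^ L"
    using LIMSEQ_le_const2[OF lim] by blast
qed

end

section \<open>Grid boxes and covering numbers\<close>

definition digit_seqs :: "('d \<Rightarrow> nat) \<Rightarrow> (nat \<Rightarrow> 'd \<Rightarrow> int) set" where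
  "digit_seqs m = {x. \<forall>k. x k \<in> digits m}"

text \<open>A grid box is indexed by digits rather than by the position of a point. A point with
  several expansions may have several codes, so counting codes is a purely symbolic task.\<close>

definition square_code :: "('d \<Rightarrow> nat) \<Rightarrow> ('d \<Rightarrow> nat) \<Rightarrow> (nat \<Rightarrow> 'd \<Rightarrow> int) \<Rightarrow> 'd \<Rightarrow> int" where
  "square_code m L x = (\<lambda>r. base_code (m r) (\<lambda>k. x k r) (L r))"

lemma digit_seqs_bounds: "x \<in> digit_seqs m \<Longrightarrow> 0 \<le> x k r \<and> x k r < int (m r)"
  unfolding digit_seqs_def digits_def by auto

lemma square_code_eq_iff:
  assumes "x \<in> digit_seqs m" "y \<in> digit_seqs m"
  shows "square_code m L x = square_code m L y \<longleftrightarrow> (\<forall>r. \<forall>k<L r. x k r = y k r)"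
proof -
  have "base_code (m r) (\<lambda>k. x k r) (L r) = base_code (m r) (\<lambda>k. y k r) (L r) \<longleftrightarrow>
      (\<forall>k<L r. x k r = y k r)" for r
    by (intro base_code_eq_iff digit_seqs_bounds assms)
  then show ?thesis
    by (simp add: square_code_def fun_eq_iff)
qed

context
  fixes m :: "'d::finite \<Rightarrow> nat" and X :: "(nat \<Rightarrow> 'd \<Rightarrow> int) set"
  assumes m: "\<And>r. 2 \<le> m r" and X: "X \<subseteq> digit_seqs m"
begin

lemma coding_map_nth:
  assumes "x \<in> X"
  shows "coding_map m x $ r = (\<Sum>k. real_of_int (x k r) / real (m r) ^ (k + 1))"
proof -
  let ?f = "\<lambda>k. \<chi> r. real_of_int (x k r) / real (m r) ^ (k + 1)"
  have x: "x \<in> digit_seqs m" using assms X by blast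
  have "?f sums (\<chi> r. \<Sum>k. real_of_int (x k r) / real (m r) ^ (k + 1))"
    unfolding sums_def
  proof (rule vec_tendstoI)
    fix r
    have "(\<lambda>n. \<Sum>k<n. real_of_int (x k r) / real (m r) ^ (k + 1)) \<longlonglongrightarrow>
        (\<Sum>k. real_of_int (x k r) / real (m r) ^ (k + 1))"
      by (intro summable_LIMSEQ summable_expansion m digit_seqs_bounds x)
    then show "(\<lambda>n. (\<Sum>k<n. ?f k) $ r) \<longlonglongrightarrow>
        (\<chi> r. \<Sum>k. real_of_int (x k r) / real (m r) ^ (k + 1)) $ r"
      by simp
  qed
  then show ?thesis
    unfolding coding_map_def using sums_unique[symmetric] by fastforce
qed

lemma coding_map_nth_bounds:
  assumes "x \<in> X"
  shows "real_of_int (square_code m L x r) / real (m r) ^ L r \<le> coding_map m x $ r"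
    "coding_map m x $ r \<le> (real_of_int (square_code m L x r) + 1) / real (m r) ^ L r"
proof -
  have x: "x \<in> digit_seqs m" using assms X by blast
  show "real_of_int (square_code m L x r) / real (m r) ^ L r \<le> coding_map m x $ r"
    "coding_map m x $ r \<le> (real_of_int (square_code m L x r) + 1) / real (m r) ^ L r"
    unfolding square_code_def coding_map_nth[OF assms]
    by (intro expansion_bounds m digit_seqs_bounds x)+
qed

lemma finite_square_codes: "finite (square_code m L ` X)"
proof (rule finite_subset)
  show "square_code m L ` X \<subseteq> (\<Pi>\<^sub>E r\<in>UNIV. {0..<int (m r) ^ L r})"
  proof
    fix c assume "c \<in> square_code m L ` X"
    then obtain x where x: "x \<in> digit_seqs m" "c = square_code m L x"
      using X by blast
    have "0 \<le> c r \<and> c r < int (m r) ^ L r" for r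
      unfolding x(2) square_code_def by (intro base_code_range digit_seqs_bounds x(1))
    then show "c \<in> (\<Pi>\<^sub>E r\<in>UNIV. {0..<int (m r) ^ L r})"
      by auto
  qed
qed (auto intro: finite_PiE)

lemma square_cover:
  assumes "\<And>r. real CARD('d) / real (m r) ^ L r \<le> \<delta>"
  obtains F where "finite F" "card F \<le> card (square_code m L ` X)" "coding_map m ` X \<subseteq> \<Union>F"
    "\<And>U. U \<in> F \<Longrightarrow> bounded U \<and> diameter U \<le> \<delta>"
proof -
  define U where "U c = coding_map m ` {x \<in> X. square_code m L x = c}" for c
  have dist: "norm (p - q) \<le> \<delta>" if pq: "p \<in> U c" "q \<in> U c" for p q c
  proof -
    obtain x y where xy: "x \<in> X" "y \<in> X" "square_code m L x = c" "square_code m L y = c"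
      "p = coding_map m x" "q = coding_map m y"
      using pq by (auto simp: U_def)
    \<comment> \<open>The Euclidean norm is bounded by the sum of the absolute coordinates, hence
      \<open>CARD('d)\<close> in the scale condition.\<close>
    have "\<bar>(p - q) $ r\<bar> \<le> \<delta> / real CARD('d)" for r
    proof -
      have "\<bar>(p - q) $ r\<bar> \<le> 1 / real (m r) ^ L r"
        using coding_map_nth_bounds[OF xy(1), where L = L and r = r] coding_map_nth_bounds[OF xy(2), where L = L and r = r] xy(3-6)
        by (simp add: add_divide_distrib)
      also have "\<dots> \<le> \<delta> / real CARD('d)"
        using assms[of r] by (simp add: field_simps)
      finally show ?thesis .
    qed
    then have "(\<Sum>r\<in>UNIV. \<bar>(p - q) $ r\<bar>) \<le> (\<Sum>r\<in>(UNIV :: 'd set). \<delta> / real CARD('d))"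
      by (intro sum_mono)
    then show ?thesis
      using norm_le_l1_cart[of "p - q"] by simp
  qed
  have "bounded (U c) \<and> diameter (U c) \<le> \<delta>" if "c \<in> square_code m L ` X" for c
  proof
    have ne: "U c \<noteq> {}"
      using that by (auto simp: U_def)
    then obtain p where "p \<in> U c" by blast
    then show "bounded (U c)"
      using dist unfolding bounded_def dist_norm by blast
    show "diameter (U c) \<le> \<delta>"
      by (rule diameter_le) (use ne dist in auto)
  qed
  moreover have "coding_map m ` X \<subseteq> \<Union>(U ` square_code m L ` X)"
    by (auto simp: U_def)
  ultimately show ?thesis
    using that[of "U ` square_code m L ` X"] finite_square_codes card_image_le by blast
qed

lemma covering_number_le:
  assumes "\<And>r. real CARD('d) / real (m r) ^ L r \<le> \<delta>"
  shows "covering_number (coding_map m ` X) \<delta> \<le> card (square_code m L ` X)"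
proof -
  obtain F where F: "finite F" "card F \<le> card (square_code m L ` X)" "coding_map m ` X \<subseteq> \<Union>F"
    "\<And>U. U \<in> F \<Longrightarrow> bounded U \<and> diameter U \<le> \<delta>"
    using square_cover[OF assms] by blast
  have "covering_number (coding_map m ` X) \<delta> \<le> card F"
    unfolding covering_number_def by (intro Least_le exI[of _ F]) (use F in auto)
  with F(2) show ?thesis by simp
qed

text \<open>A set of diameter at most \<delta> extends over at most one cell width in each
  coordinate, so it meets few codes. The depths \<open>L'\<close> supply a finite cover, so that the
  \<open>LEAST\<close> in the covering number is attained.\<close>

lemma card_square_codes_le:
  assumes "\<And>r. real CARD('d) / real (m r) ^ L' r \<le> \<delta>" and L: "\<And>r. \<delta> \<le> 1 / real (m r) ^ L r"
  shows "card (square_code m L ` X) \<le> covering_number (coding_map m ` X) \<delta> * 5 ^ CARD('d)"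
proof -
  obtain F' where F': "finite F'" "coding_map m ` X \<subseteq> \<Union>F'" "\<And>U. U \<in> F' \<Longrightarrow> bounded U \<and> diameter U \<le> \<delta>"
    using square_cover[OF assms(1)] by metis
  have "\<exists>n F. finite F \<and> card F = n \<and> coding_map m ` X \<subseteq> \<Union>F \<and> (\<forall>U\<in>F. bounded U \<and> diameter U \<le> \<delta>)"
    by (intro exI[of _ F'] exI[of _ "card F'"]) (use F' in auto)
  from LeastI_ex[OF this] obtain F where F: "finite F" "card F = covering_number (coding_map m ` X) \<delta>"
    "coding_map m ` X \<subseteq> \<Union>F" "\<And>U. U \<in> F \<Longrightarrow> bounded U \<and> diameter U \<le> \<delta>"
    unfolding covering_number_def by blast
  define Q where "Q U = square_code m L ` {x \<in> X. coding_map m x \<in> U}" for U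
  have card_Q: "card (Q U) \<le> 5 ^ CARD('d)" if U: "U \<in> F" for U
  proof (cases "Q U = {}")
    case False
    then obtain x0 where x0: "x0 \<in> X" "coding_map m x0 \<in> U"
      by (auto simp: Q_def)
    \<comment> \<open>After scaling, two points of \<open>U\<close> differ by at most 1 in each
      coordinate, and each exceeds its code by at most 1. Codes thus differ by at most 2, leaving 5
      = 2 + 1 + 2 values.\<close>
    define P where "P = (\<Pi>\<^sub>E r\<in>UNIV. {square_code m L x0 r - 2..square_code m L x0 r + 2})"
    have "\<bar>square_code m L x r - square_code m L x0 r\<bar> \<le> 2" if x: "x \<in> X" "coding_map m x \<in> U" for x r
    proof -
      have pos: "0 < real (m r) ^ L r"
        using m[of r] by simp
      have "\<bar>coding_map m x $ r - coding_map m x0 $ r\<bar> \<le> dist (coding_map m x) (coding_map m x0)"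
        using component_le_norm_cart[of "coding_map m x - coding_map m x0" r] by (simp add: dist_norm)
      also have "\<dots> \<le> diameter U"
        using F(4)[OF U] x(2) x0(2) by (intro diameter_bounded_bound) auto
      also have "\<dots> \<le> 1 / real (m r) ^ L r"
        using F(4)[OF U] L[of r] by simp
      finally have "\<bar>coding_map m x $ r - coding_map m x0 $ r\<bar> * real (m r) ^ L r \<le> 1"
        by (simp only: pos_le_divide_eq[OF pos])
      then have "\<bar>coding_map m x $ r * real (m r) ^ L r - coding_map m x0 $ r * real (m r) ^ L r\<bar> \<le> 1"
        using pos by (simp only: abs_mult_pos[OF less_imp_le] left_diff_distrib)
      moreover have "real_of_int (square_code m L z r) \<le> coding_map m z $ r * real (m r) ^ L r"
        "coding_map m z $ r * real (m r) ^ L r \<le> real_of_int (square_code m L z r) + 1" if "z \<in> X" for z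
        using coding_map_nth_bounds[OF that, where L = L and r = r] by (simp_all only: pos_divide_le_eq[OF pos] pos_le_divide_eq[OF pos])
      ultimately have "\<bar>real_of_int (square_code m L x r - square_code m L x0 r)\<bar> \<le> 2"
        using x(1) x0(1) by (smt (verit) of_int_diff)
      then show ?thesis by linarith
    qed
    then have "Q U \<subseteq> P"
      unfolding P_def Q_def by (auto simp: abs_le_iff) (smt (verit))+
    moreover have "finite P"
      unfolding P_def by (intro finite_PiE) auto
    ultimately have "card (Q U) \<le> card P"
      by (intro card_mono)
    also have "card P = 5 ^ CARD('d)"
      unfolding P_def by (subst card_PiE) auto
    finally show ?thesis .
  qed simp
  have "square_code m L ` X \<subseteq> (\<Union>U\<in>F. Q U)"
    using F(3) by (fastforce simp: Q_def)
  moreover have "finite (Q U)" for U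
    by (rule finite_subset[OF _ finite_square_codes[of L]]) (auto simp: Q_def)
  ultimately have "card (square_code m L ` X) \<le> card (\<Union>U\<in>F. Q U)"
    using F(1) by (intro card_mono) auto
  also have "\<dots> \<le> (\<Sum>U\<in>F. card (Q U))"
    by (rule card_UN_le) fact
  also have "\<dots> \<le> card F * 5 ^ CARD('d)"
    using sum_bounded_above[of F "\<lambda>U. card (Q U)" "5 ^ CARD('d)"] card_Q by simp
  finally show ?thesis
    unfolding F(2) .
qed

end

section \<open>From grid boxes to words along paths\<close>

lemma card_image_eq_card_image:
  assumes "\<And>x y. x \<in> A \<Longrightarrow> y \<in> A \<Longrightarrow> f x = f y \<longleftrightarrow> g x = g y"
  shows "card (f ` A) = card (g ` A)"
proof -
  have "bij_betw (\<lambda>c. g (inv_into A f c)) (f ` A) (g ` A)"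
  proof (rule bij_betw_imageI)
    show "inj_on (\<lambda>c. g (inv_into A f c)) (f ` A)"
    proof (rule inj_onI)
      fix c d assume "c \<in> f ` A" "d \<in> f ` A" "g (inv_into A f c) = g (inv_into A f d)"
      then show "c = d"
        using assms[of "inv_into A f c" "inv_into A f d"] by (simp add: inv_into_into f_inv_into_f)
    qed
    have "g (inv_into A f (f x)) = g x" if "x \<in> A" for x
      using assms[of "inv_into A f (f x)" x] that by (simp add: inv_into_into f_inv_into_f)
    then show "(\<lambda>c. g (inv_into A f c)) ` f ` A = g ` A"
      by (auto simp: image_image)
  qed
  then show ?thesis
    by (rule bij_betw_same_card)
qed

definition steps :: "(nat \<Rightarrow> nat) \<Rightarrow> nat \<Rightarrow> nat" where
  "steps L i = L i - L (i - 1)"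

text \<open>The map \<open>blk\<close> gives the block number of a coordinate and replaces the
  thresholds \<open>dd\<close>: counting squares only asks to which block a coordinate
  belongs.\<close>

locale square_counting = finite_digraph V E
  for V :: "'v set" and E :: "('v \<times> 'v) set" +
  fixes m :: "'d::finite \<Rightarrow> nat" and lab :: "'v \<Rightarrow> 'd \<Rightarrow> int" and blk :: "'d \<Rightarrow> nat" and s :: nat
  assumes lab: "lab \<in> V \<rightarrow> digits m" and blk: "\<And>r. blk r \<in> {1..s}" and s: "1 \<le> s"
    and walks_nonempty: "walks V E \<noteq> {}"
begin

definition seqs :: "(nat \<Rightarrow> 'd \<Rightarrow> int) set" where
  "seqs = label_image lab (walks V E)"

text \<open>The composition of tau_i with \<open>lab\<close>, in terms of block numbers. Deleted
  coordinates take a fixed default value, so equality compares exactly the kept ones.\<close>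

definition block_lab :: "nat \<Rightarrow> 'v \<Rightarrow> 'd \<Rightarrow> int" where
  "block_lab i v = restrict (lab v) {r. i \<le> blk r}"

definition N_squares :: "(nat \<Rightarrow> nat) \<Rightarrow> nat" where
  "N_squares L = card (square_code m (L \<circ> blk) ` seqs)"

text \<open>Position \<open>k\<close> shows the coordinates whose depth exceeds \<open>k\<close>.
  For increasing depths \<open>L s\<close> is the largest, so later positions would show
  nothing.\<close>

definition visible :: "(nat \<Rightarrow> nat) \<Rightarrow> (nat \<Rightarrow> 'd \<Rightarrow> int) \<Rightarrow> ('d \<Rightarrow> int) list" where
  "visible L x = map (\<lambda>k. restrict (x k) {r. k < L (blk r)}) [0..<L s]"

lemma seqs_digit_seqs: "seqs \<subseteq> digit_seqs m"
  using lab unfolding seqs_def label_image_def walks_def digit_seqs_def by fastforce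

lemma seqs_nonempty: "seqs \<noteq> {}"
  using walks_nonempty by (simp add: seqs_def label_image_def)

context
  fixes L :: "nat \<Rightarrow> nat"
  assumes L0: "L 0 = 0" and L_mono: "\<forall>i\<in>{1..s}. L (i - 1) \<le> L i"
begin

lemma L_le: "i \<le> j \<Longrightarrow> j \<le> s \<Longrightarrow> L i \<le> L j"
proof (induction j rule: dec_induct)
  case (step k)
  then show ?case using L_mono[rule_format, of "Suc k"] by simp
qed simp

text \<open>Positions from \<open>L j\<close> up to \<open>L (Suc j)\<close> are too deep for the
  blocks up to \<open>j\<close> and still within reach of all later ones, so exactly the coordinates
  kept by \<open>block_lab (Suc j)\<close> are visible there.\<close>

lemma block_labels_eq:
  "j \<le> s \<Longrightarrow> block_labels block_lab (steps L) j =
    map (\<lambda>k v. restrict (lab v) {r. k < L (blk r)}) [0..<L j]"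
proof (induction j)
  case (Suc j)
  have le: "L j \<le> L (Suc j)"
    using L_mono[rule_format, of "Suc j"] Suc.prems by simp
  have "{r. k < L (blk r)} = {r. Suc j \<le> blk r}" if "L j \<le> k" "k < L (Suc j)" for k
  proof (intro Collect_cong iffI)
    fix r assume "k < L (blk r)"
    then show "Suc j \<le> blk r"
      using L_le[of "blk r" j] Suc.prems that by (metis Suc_leD leD le_less_trans not_less_eq_eq)
  next
    fix r assume "Suc j \<le> blk r"
    then show "k < L (blk r)"
      using L_le[of "Suc j" "blk r"] blk[of r] that by simp
  qed
  then have "map (\<lambda>k v. restrict (lab v) {r. k < L (blk r)}) [L j..<L (Suc j)] =
      map (\<lambda>k. block_lab (Suc j)) [L j..<L (Suc j)]"
    by (intro map_cong refl) (auto simp: block_lab_def)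
  also have "\<dots> = replicate (steps L (Suc j)) (block_lab (Suc j))"
    by (simp add: map_replicate_const steps_def)
  finally have last: "map (\<lambda>k v. restrict (lab v) {r. k < L (blk r)}) [L j..<L (Suc j)] =
      replicate (steps L (Suc j)) (block_lab (Suc j))" .
  have upt: "[0..<L (Suc j)] = [0..<L j] @ [L j..<L (Suc j)]"
    using le upt_add_eq_append[of 0 "L j" "L (Suc j) - L j"] by simp
  show ?case
    by (simp only: block_labels.simps upt map_append last Suc.IH[OF Suc_leD[OF Suc.prems]])
qed (simp add: L0)

lemma length_block_labels: "length (block_labels block_lab (steps L) s) = L s"
  by (simp add: block_labels_eq)

lemma N_squares_eq: "N_squares L = card (visible L ` seqs)"
  unfolding N_squares_def
proof (rule card_image_eq_card_image)
  fix x y assume xy: "x \<in> seqs" "y \<in> seqs"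
  then have "square_code m (L \<circ> blk) x = square_code m (L \<circ> blk) y \<longleftrightarrow> (\<forall>r. \<forall>k<L (blk r). x k r = y k r)"
    using square_code_eq_iff[OF subsetD[OF seqs_digit_seqs xy(1)] subsetD[OF seqs_digit_seqs xy(2)]] by simp
  also have "\<dots> \<longleftrightarrow> (\<forall>k<L s. \<forall>r. k < L (blk r) \<longrightarrow> x k r = y k r)"
    using L_le[of "blk _" s] blk by (auto dest: less_le_trans)
  also have "\<dots> \<longleftrightarrow> (\<forall>k<L s. restrict (x k) {r. k < L (blk r)} = restrict (y k) {r. k < L (blk r)})"
    by (auto simp: restrict_def fun_eq_iff)
  also have "\<dots> \<longleftrightarrow> visible L x = visible L y"
    by (auto simp: visible_def list_eq_iff_nth_eq)
  finally show "square_code m (L \<circ> blk) x = square_code m (L \<circ> blk) y \<longleftrightarrow> visible L x = visible L y" .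
qed

lemma visible_eq_labels:
  "visible L (lab \<circ> \<omega>) = map (\<lambda>k. (block_labels block_lab (steps L) s ! k) (\<omega> k))
    [0..<length (block_labels block_lab (steps L) s)]"
  by (simp add: block_labels_eq visible_def)

lemma visible_subset: "visible L ` seqs \<subseteq>
    (\<Union>(u, v)\<in>V \<times> V. path_words E (block_labels block_lab (steps L) s) u v)"
proof
  fix w assume "w \<in> visible L ` seqs"
  then obtain \<omega> where \<omega>: "\<omega> \<in> walks V E" "w = visible L (lab \<circ> \<omega>)"
    by (auto simp: seqs_def label_image_def)
  then have "w \<in> path_words E (block_labels block_lab (steps L) s) (\<omega> 0) (\<omega> (L s))"
    using walk_in_path_words[of \<omega> E "block_labels block_lab (steps L) s"]
    by (simp add: visible_eq_labels walks_def length_block_labels)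
  then show "w \<in> (\<Union>(u, v)\<in>V \<times> V. path_words E (block_labels block_lab (steps L) s) u v)"
    using \<omega>(1) by (auto simp: walks_def)
qed

text \<open>A vertex may have no outgoing edge, so a finite path need not come from a walk; ending
  in a component guarantees an infinite continuation.\<close>

lemma path_words_subset_visible:
  assumes "D \<in> components V E" "v \<in> D"
  shows "path_words E (block_labels block_lab (steps L) s) u v \<subseteq> visible L ` seqs"
proof
  fix w assume w: "w \<in> path_words E (block_labels block_lab (steps L) s) u v"
  obtain \<omega> where \<omega>: "\<omega> 0 = v" "\<And>k. (\<omega> k, \<omega> (Suc k)) \<in> E \<inter> D \<times> D"
    using component_walk_exists[OF assms] by blast
  then have "\<And>k. (\<omega> k, \<omega> (Suc k)) \<in> E" by blast
  from path_word_extends[OF w this \<omega>(1)] obtain \<omega>' where \<omega>': "\<And>k. (\<omega>' k, \<omega>' (Suc k)) \<in> E"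
    "w = visible L (lab \<circ> \<omega>')"
    unfolding visible_eq_labels by metis
  then have "\<omega>' \<in> walks V E"
    using E_sub by (auto simp: walks_def)
  then show "w \<in> visible L ` seqs"
    using \<omega>'(2) by (auto simp: seqs_def label_image_def)
qed

lemma finite_visible: "finite (visible L ` seqs)"
  by (rule finite_subset[OF visible_subset]) (auto intro!: finite_path_words finite_E finite_V)

end

lemma N_squares_lower:
  assumes D: "D \<in> component_chains V E s"
  shows "\<exists>c>0. \<forall>L. L 0 = 0 \<and> (\<forall>i\<in>{1..s}. L (i - 1) + card E \<le> L i) \<longrightarrow>
    c * exp (\<Sum>i = 1..s. htop (component_seqs V E (block_lab i) (D i)) * real (steps L i)) \<le> real (N_squares L)"
proof -
  obtain c where "0 < c" and c: "\<forall>l. (\<forall>i\<in>{1..s}. card E \<le> l i) \<longrightarrow> (\<exists>u\<in>V. \<exists>v\<in>D s.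
    c * exp (\<Sum>i = 1..s. htop (component_seqs V E (block_lab i) (D i)) * real (l i)) \<le>
      real (card (path_words E (block_labels block_lab l s) u v)))"
    using chain_lower[OF D s, of block_lab] by (elim exE conjE) (rule that)
  have "c * exp (\<Sum>i = 1..s. htop (component_seqs V E (block_lab i) (D i)) * real (steps L i)) \<le> real (N_squares L)"
    if L: "L 0 = 0" "\<forall>i\<in>{1..s}. L (i - 1) + card E \<le> L i" for L
  proof -
    have mono: "\<forall>i\<in>{1..s}. L (i - 1) \<le> L i"
      using L(2) by fastforce
    have "\<forall>i\<in>{1..s}. card E \<le> steps L i"
      using L(2) by (fastforce simp: steps_def)
    from c[THEN spec, THEN mp, OF this] obtain u v where uv: "v \<in> D s"
      "c * exp (\<Sum>i = 1..s. htop (component_seqs V E (block_lab i) (D i)) * real (steps L i)) \<le>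
        real (card (path_words E (block_labels block_lab (steps L) s) u v))"
      by blast
    note uv(2)
    also have "card (path_words E (block_labels block_lab (steps L) s) u v) \<le> N_squares L"
      unfolding N_squares_eq[OF L(1) mono]
      using chain_components[OF D, of s] s uv(1)
      by (intro card_mono finite_visible[OF L(1) mono] path_words_subset_visible[OF L(1) mono]) auto
    finally show ?thesis by simp
  qed
  with \<open>0 < c\<close> show ?thesis by blast
qed

lemma N_squares_upper:
  assumes "0 < \<epsilon>"
  shows "\<exists>K>0. \<forall>L. L 0 = 0 \<and> (\<forall>i\<in>{1..s}. L (i - 1) + card V \<le> L i) \<longrightarrow>
    (\<exists>D\<in>component_chains V E s. real (N_squares L) \<le>
      K * exp (\<Sum>i = 1..s. (htop (component_seqs V E (block_lab i) (D i)) + \<epsilon>) * real (steps L i)))"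
proof -
  obtain K where "0 < K" and K: "\<forall>l. (\<forall>i\<in>{1..s}. card V \<le> l i) \<longrightarrow>
    (\<forall>u\<in>V. \<forall>v\<in>V. path_words E (block_labels block_lab l s) u v \<noteq> {} \<longrightarrow>
      (\<exists>D\<in>component_chains V E s.
        real (card (path_words E (block_labels block_lab l s) u v)) \<le>
          K * exp (\<Sum>i = 1..s. (htop (component_seqs V E (block_lab i) (D i)) + \<epsilon>) * real (l i))))"
    using chain_upper[OF assms, of s block_lab] by (elim exE conjE) (rule that)
  have V_ne: "V \<noteq> {}"
    using walks_nonempty by (auto simp: walks_def)
  let ?c = "real (card (V \<times> V))"
  have "\<exists>D\<in>component_chains V E s. real (N_squares L) \<le>
      (?c * K) * exp (\<Sum>i = 1..s. (htop (component_seqs V E (block_lab i) (D i)) + \<epsilon>) * real (steps L i))"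
    if L: "L 0 = 0" "\<forall>i\<in>{1..s}. L (i - 1) + card V \<le> L i" for L
  proof -
    have mono: "\<forall>i\<in>{1..s}. L (i - 1) \<le> L i"
      using L(2) by fastforce
    have long: "\<forall>i\<in>{1..s}. card V \<le> steps L i"
      using L(2) by (fastforce simp: steps_def)
    define W where "W = (\<lambda>(u, v). path_words E (block_labels block_lab (steps L) s) u v)"
    have fin: "finite (V \<times> V)" and ne: "V \<times> V \<noteq> {}"
      using finite_V V_ne by auto
    have finW: "finite (W p)" for p
      by (cases p) (auto simp: W_def intro: finite_path_words finite_E)
    \<comment> \<open>One pair of end vertices accounts for all visible words up to the factor
      \<open>card (V \<times> V)\<close>.\<close>
    obtain p where p: "p \<in> V \<times> V" "(\<Sum>p\<in>V \<times> V. card (W p)) \<le> card (V \<times> V) * card (W p)"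
      using sum_le_card_times_member[OF fin ne] by blast
    obtain u v where uv: "p = (u, v)" "u \<in> V" "v \<in> V"
      using p(1) by auto
    have "N_squares L = card (visible L ` seqs)"
      by (rule N_squares_eq[OF L(1) mono])
    also have "\<dots> \<le> card (\<Union>p\<in>V \<times> V. W p)"
      using visible_subset[OF L(1) mono] finW finite_V by (intro card_mono) (auto simp: W_def)
    also have "\<dots> \<le> (\<Sum>p\<in>V \<times> V. card (W p))"
      by (rule card_UN_le[OF fin])
    also note p(2)
    finally have count: "N_squares L \<le> card (V \<times> V) * card (W p)" .
    have "0 < N_squares L"
      using N_squares_eq[OF L(1) mono] finite_visible[OF L(1) mono] seqs_nonempty
      by (simp add: card_gt_0_iff)
    then have "W p \<noteq> {}"
      using count by auto
    then obtain D where D: "D \<in> component_chains V E s" "real (card (W p)) \<le>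
          K * exp (\<Sum>i = 1..s. (htop (component_seqs V E (block_lab i) (D i)) + \<epsilon>) * real (steps L i))"
      using K[THEN spec, THEN mp, OF long, THEN bspec, OF uv(2), THEN bspec, OF uv(3)] \<open>W p \<noteq> {}\<close> unfolding W_def uv(1) prod.case by blast
    have "real (N_squares L) \<le> ?c * real (card (W p))"
      using count by (metis of_nat_le_iff of_nat_mult)
    also have "\<dots> \<le> ?c * (K * exp (\<Sum>i = 1..s. (htop (component_seqs V E (block_lab i) (D i)) + \<epsilon>) * real (steps L i)))"
      using D(2) by (intro mult_left_mono) auto
    finally show ?thesis
      using D(1) by (auto simp: mult.assoc)
  qed
  moreover have "0 < ?c * K"
    using \<open>0 < K\<close> finite_V V_ne by (simp add: card_gt_0_iff card_cartesian_product)
  ultimately show ?thesis by blast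
qed

end

section \<open>Asymptotics\<close>

text \<open>Separates the analysis from the dynamics. One maximising \<open>D\<close> suffices for
  the lower bound; in the upper bound \<open>D\<close> may change with \<open>x\<close>, and
  finiteness of \<open>C\<close> makes the estimate hold for all of them simultaneously.\<close>

lemma growth_rate:
  fixes N :: "'x \<Rightarrow> nat" and L :: "'x \<Rightarrow> nat \<Rightarrow> nat" and t :: "'x \<Rightarrow> real"
    and b :: "nat \<Rightarrow> real" and h :: "'c \<Rightarrow> nat \<Rightarrow> real"
  assumes t: "filterlim t at_top F"
    and L: "\<And>i. i \<le> s \<Longrightarrow> ((\<lambda>x. real (L x i) / t x) \<longlongrightarrow> b i) F"
    and b: "\<And>i. i \<in> {1..s} \<Longrightarrow> b (i - 1) < b i"
    and C: "finite C" "C \<noteq> {}"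
    and lower: "\<And>D. D \<in> C \<Longrightarrow> \<exists>c>0. \<forall>x. (\<forall>i\<in>{1..s}. L x (i - 1) + B \<le> L x i) \<longrightarrow>
      c * exp (\<Sum>i = 1..s. h D i * real (steps (L x) i)) \<le> real (N x)"
    and upper: "\<And>\<epsilon>. 0 < \<epsilon> \<Longrightarrow> \<exists>K>0. \<forall>x. (\<forall>i\<in>{1..s}. L x (i - 1) + B \<le> L x i) \<longrightarrow>
      (\<exists>D\<in>C. real (N x) \<le> K * exp (\<Sum>i = 1..s. (h D i + \<epsilon>) * real (steps (L x) i)))"
  shows "((\<lambda>x. ln (real (N x)) / t x) \<longlongrightarrow> Max ((\<lambda>D. \<Sum>i = 1..s. h D i * (b i - b (i - 1))) ` C)) F"
proof -
  define S where "S D = (\<Sum>i = 1..s. h D i * (b i - b (i - 1)))" for D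
  define T where "T = (\<Sum>i = 1..s. b i - b (i - 1))"
  have T: "0 \<le> T"
    unfolding T_def using b by (intro sum_nonneg) (auto simp: less_imp_le)
  have t_pos: "eventually (\<lambda>x. 0 < t x) F"
    using t by (auto simp: filterlim_at_top_dense)
  have diff_lim: "((\<lambda>x. (real (L x i) - real (L x (i - 1))) / t x) \<longlongrightarrow> b i - b (i - 1)) F" if "i \<in> {1..s}" for i
    unfolding diff_divide_distrib using that by (intro tendsto_diff L) auto
  \<comment> \<open>The strict increase of \<open>b\<close> makes each segment grow linearly in
    \<open>t\<close>, past any fixed threshold.\<close>
  have "eventually (\<lambda>x. L x (i - 1) + B \<le> L x i) F" if i: "i \<in> {1..s}" for i
  proof -
    have "filterlim (\<lambda>x. (real (L x i) - real (L x (i - 1))) / t x * t x) at_top F"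
      using diff_lim[OF i] _ t by (rule filterlim_tendsto_pos_mult_at_top) (use b[OF i] in simp)
    then have "eventually (\<lambda>x. real B \<le> (real (L x i) - real (L x (i - 1))) / t x * t x) F"
      by (auto simp: filterlim_at_top)
    then show ?thesis
      using t_pos by eventually_elim simp
  qed
  then have good: "eventually (\<lambda>x. \<forall>i\<in>{1..s}. L x (i - 1) + B \<le> L x i) F"
    by (intro eventually_ball_finite) auto
  have step_lim: "((\<lambda>x. real (steps (L x) i) / t x) \<longlongrightarrow> b i - b (i - 1)) F" if "i \<in> {1..s}" for i
  proof (rule Lim_transform_eventually[OF diff_lim[OF that]])
    show "eventually (\<lambda>x. (real (L x i) - real (L x (i - 1))) / t x = real (steps (L x) i) / t x) F"
      using good
    proof eventually_elim
      case (elim x)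
      then have "L x (i - 1) + B \<le> L x i"
        using that by blast
      then show ?case by (simp add: steps_def of_nat_diff)
    qed
  qed
  have const_lim: "((\<lambda>x. c / t x) \<longlongrightarrow> 0) F" for c
    using t by (intro real_tendsto_divide_at_top[OF tendsto_const])
  have sum_lim: "((\<lambda>x. ln c / t x + (\<Sum>i = 1..s. a i * (real (steps (L x) i) / t x))) \<longlongrightarrow>
      0 + (\<Sum>i = 1..s. a i * (b i - b (i - 1)))) F" for a :: "nat \<Rightarrow> real" and c :: real
    by (intro tendsto_add const_lim tendsto_sum tendsto_mult_left step_lim)
  \<comment> \<open>Positivity of \<open>N x\<close> is recorded because the upper estimate takes
    its logarithm as well.\<close>
  have lower': "eventually (\<lambda>x. 0 < N x \<and>
      ln c / t x + (\<Sum>i = 1..s. h D i * (real (steps (L x) i) / t x)) \<le> ln (real (N x)) / t x) F"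
    if "0 < c" and c: "\<forall>x. (\<forall>i\<in>{1..s}. L x (i - 1) + B \<le> L x i) \<longrightarrow>
      c * exp (\<Sum>i = 1..s. h D i * real (steps (L x) i)) \<le> real (N x)" for c D
    using good t_pos
  proof eventually_elim
    case (elim x)
    let ?S = "\<Sum>i = 1..s. h D i * real (steps (L x) i)"
    have le: "c * exp ?S \<le> real (N x)"
      using c elim(1) by blast
    moreover have "0 < c * exp ?S"
      using \<open>0 < c\<close> by simp
    ultimately have "0 < real (N x)"
      by linarith
    have "ln (c * exp ?S) \<le> ln (real (N x))"
      using \<open>0 < c * exp ?S\<close> le by (intro ln_mono)
    then have "ln c + ?S \<le> ln (real (N x))"
      using \<open>0 < c\<close> by (simp add: ln_mult)
    then have "(ln c + ?S) / t x \<le> ln (real (N x)) / t x"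
      using elim(2) by (intro divide_right_mono) auto
    then show ?case
      using \<open>0 < real (N x)\<close> by (simp add: add_divide_distrib sum_divide_distrib)
  qed
  have "Max (S ` C) \<in> S ` C"
    using C by (intro Max_in) auto
  then obtain D0 where D0: "D0 \<in> C" "S D0 = Max (S ` C)" by auto
  obtain c0 where "0 < c0" and c0: "\<forall>x. (\<forall>i\<in>{1..s}. L x (i - 1) + B \<le> L x i) \<longrightarrow>
      c0 * exp (\<Sum>i = 1..s. h D0 i * real (steps (L x) i)) \<le> real (N x)"
    using lower[OF D0(1)] by blast
  have "((\<lambda>x. ln (real (N x)) / t x) \<longlongrightarrow> Max (S ` C)) F"
  proof (rule order_tendstoI)
    fix a assume "a < Max (S ` C)"
    then have "eventually (\<lambda>x. a < ln c0 / t x + (\<Sum>i = 1..s. h D0 i * (real (steps (L x) i) / t x))) F"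
      using order_tendstoD(1)[OF sum_lim[of c0 "h D0"], of a] D0(2) by (simp add: S_def)
    then show "eventually (\<lambda>x. a < ln (real (N x)) / t x) F"
      using lower'[OF \<open>0 < c0\<close> c0] by eventually_elim linarith
  next
    fix a assume a: "Max (S ` C) < a"
    \<comment> \<open>Raising every rate by \<epsilon> raises the limit by
      \<open>\<epsilon> * T\<close>. The factor 2 leaves half of the gap, and \<open>T + 1\<close>
      keeps the denominator positive.\<close>
    define \<epsilon> where "\<epsilon> = (a - Max (S ` C)) / (2 * (T + 1))"
    have \<epsilon>: "0 < \<epsilon>"
      using a T by (simp add: \<epsilon>_def)
    have "\<epsilon> * T \<le> \<epsilon> * (T + 1)"
      using \<epsilon> by simp
    also have "\<dots> = (a - Max (S ` C)) / 2"
      using T by (simp add: \<epsilon>_def field_simps)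
    finally have \<epsilon>T: "Max (S ` C) + \<epsilon> * T < a"
      using a by simp
    obtain K where "0 < K" and K: "\<forall>x. (\<forall>i\<in>{1..s}. L x (i - 1) + B \<le> L x i) \<longrightarrow>
      (\<exists>D\<in>C. real (N x) \<le> K * exp (\<Sum>i = 1..s. (h D i + \<epsilon>) * real (steps (L x) i)))"
      using upper[OF \<epsilon>] by blast
    have "eventually (\<lambda>x. ln K / t x + (\<Sum>i = 1..s. (h D i + \<epsilon>) * (real (steps (L x) i) / t x)) < a) F"
      if "D \<in> C" for D
    proof -
      have "(\<Sum>i = 1..s. (h D i + \<epsilon>) * (b i - b (i - 1))) = S D + \<epsilon> * T"
        by (simp add: S_def T_def distrib_right sum.distrib sum_distrib_left)
      moreover have "S D \<le> Max (S ` C)"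
        using that C by simp
      ultimately show ?thesis
        using \<epsilon>T by (intro order_tendstoD(2)[OF sum_lim]) simp
    qed
    then have "eventually (\<lambda>x. \<forall>D\<in>C. ln K / t x + (\<Sum>i = 1..s. (h D i + \<epsilon>) * (real (steps (L x) i) / t x)) < a) F"
      using C(1) by (intro eventually_ball_finite) auto
    then show "eventually (\<lambda>x. ln (real (N x)) / t x < a) F"
      using good t_pos lower'[OF \<open>0 < c0\<close> c0]
    proof eventually_elim
      case (elim x)
      from K elim(2) obtain D where D: "D \<in> C"
        "real (N x) \<le> K * exp (\<Sum>i = 1..s. (h D i + \<epsilon>) * real (steps (L x) i))"
        by blast
      let ?S = "\<Sum>i = 1..s. (h D i + \<epsilon>) * real (steps (L x) i)"
      have "ln (real (N x)) \<le> ln (K * exp ?S)"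
        using D(2) elim(4) by (intro ln_mono) auto
      also have "\<dots> = ln K + ?S"
        using \<open>0 < K\<close> by (simp add: ln_mult)
      finally have "ln (real (N x)) / t x \<le> (ln K + ?S) / t x"
        using elim(3) by (intro divide_right_mono) auto
      also have "\<dots> = ln K / t x + (\<Sum>i = 1..s. (h D i + \<epsilon>) * (real (steps (L x) i) / t x))"
        by (simp add: add_divide_distrib sum_divide_distrib)
      also have "\<dots> < a"
        using elim(1) D(1) by blast
      finally show ?case .
    qed
  qed
  then show ?thesis
    unfolding S_def .
qed

section \<open>Logarithmic scales and the box dimension\<close>

lemma ratio_tendsto:
  fixes f t :: "'x \<Rightarrow> real"
  assumes "filterlim t at_top F" "eventually (\<lambda>x. \<bar>f x - t x * b\<bar> \<le> c) F"
  shows "((\<lambda>x. f x / t x) \<longlongrightarrow> b) F"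
proof -
  have t_pos: "eventually (\<lambda>x. 0 < t x) F"
    using assms(1) by (auto simp: filterlim_at_top_dense)
  have "((\<lambda>x. f x / t x - b) \<longlongrightarrow> 0) F"
  proof (rule Lim_null_comparison)
    show "((\<lambda>x. c / t x) \<longlongrightarrow> 0) F"
      using assms(1) by (intro real_tendsto_divide_at_top[OF tendsto_const])
    show "eventually (\<lambda>x. norm (f x / t x - b) \<le> c / t x) F"
      using t_pos assms(2)
    proof eventually_elim
      case (elim x)
      have "f x / t x - b = (f x - t x * b) / t x"
        using elim(1) by (simp add: field_simps)
      then show ?case
        using elim by (simp add: divide_right_mono)
    qed
  qed
  then show ?thesis
    by (simp add: LIM_zero_iff)
qed

lemma power_eq_exp_ln: "2 \<le> b \<Longrightarrow> real b ^ k = exp (real k * ln (real b))"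
  by (simp add: exp_of_nat_mult)

theorem proposition7p2:
  fixes m :: "'d::{finite,linorder} \<Rightarrow> nat"
    and n dd :: "nat \<Rightarrow> nat" and s :: nat
    and X :: "(nat \<Rightarrow> 'd \<Rightarrow> int) set"
    and V :: "'v set" and E :: "('v \<times> 'v) set" and lab :: "'v \<Rightarrow> 'd \<Rightarrow> int"
  assumes "antimono m" and "\<And>r. 2 \<le> m r"
    and "\<And>i j. 1 \<le> i \<Longrightarrow> i < j \<Longrightarrow> j \<le> s \<Longrightarrow> n j < n i" and "n ` {1..s} = range m"
    and "2 \<le> s"
    and "dd 0 = 0" and "\<And>i. i < s \<Longrightarrow> dd i < dd (i + 1)" and "dd s = CARD('d)"
    and "\<And>i r. 1 \<le> i \<Longrightarrow> i \<le> s \<Longrightarrow> dd (i - 1) < coord_num r \<Longrightarrow> coord_num r \<le> dd i \<Longrightarrow> m r = n i"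
    and "subshift (digits m) X"
    and "graph_presentation (digits m) V E lab X"
  shows "has_box_dimension (coding_map m ` X)
    (1 / ln (real (n s)) *
      Max {\<Sum>i = 1..s. (theta n s i - theta n s (i - 1)) * component_entropy dd V E lab i (D i)
            | D. D \<in> component_chains V E s})"
proof -
  have dd_mono: "dd i \<le> dd j" if "i \<le> j" "j \<le> s" for i j
    using that
  proof (induction j rule: dec_induct)
    case (step k)
    then show ?case using assms(7)[of k] by simp
  qed simp
  have coord: "1 \<le> coord_num r" "coord_num r \<le> CARD('d)" for r :: 'd
    using bij_betw_apply[OF bij_betw_coord_num, of r] by auto
  \<comment> \<open>As \<open>dd\<close> increases up to \<open>CARD('d)\<close>, the least such
    index is the block containing \<open>r\<close>.\<close>
  define blk where "blk r = (LEAST i. coord_num r \<le> dd i)" for r :: 'd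
  have blk_upper: "coord_num r \<le> dd (blk r)" for r
    unfolding blk_def using coord(2)[of r] assms(8)
    by (intro LeastI[where P = "\<lambda>i. coord_num r \<le> dd i" and k = s]) simp
  have blk_le: "blk r \<le> s" for r
    unfolding blk_def using coord(2)[of r] assms(8) by (auto intro: Least_le)
  have blk_range: "blk r \<in> {1..s}" for r
    using blk_upper[of r] blk_le[of r] coord(1)[of r] assms(6) by (cases "blk r = 0") auto
  have blk_iff: "i \<le> blk r \<longleftrightarrow> dd (i - 1) < coord_num r" if "i \<in> {1..s}" for i r
  proof
    assume "i \<le> blk r"
    then have "i - 1 < blk r" using that by auto
    then show "dd (i - 1) < coord_num r"
      unfolding blk_def using not_less_Least by (metis not_le)
  next
    assume *: "dd (i - 1) < coord_num r"
    show "i \<le> blk r"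
    proof (rule ccontr)
      assume "\<not> i \<le> blk r"
      then have "dd (blk r) \<le> dd (i - 1)"
        using that by (intro dd_mono) auto
      with * blk_upper[of r] show False by simp
    qed
  qed
  have m_blk: "m r = n (blk r)" for r
    using blk_range[of r] blk_iff[of "blk r" r] blk_upper[of r] by (intro assms(9)) auto
  have n_ge: "2 \<le> n i" if "i \<in> {1..s}" for i
  proof -
    have "n i \<in> range m" using that assms(4) by blast
    then show ?thesis using assms(2) by auto
  qed
  have pres: "finite V" "E \<subseteq> V \<times> V" "lab \<in> V \<rightarrow> digits m" "X = label_image lab (walks V E)"
    using assms(11) by (auto simp: graph_presentation_def)
  have "X \<noteq> {}"
    using assms(10) by (simp add: subshift_def)
  interpret square_counting V E m lab blk s
    by standard (use pres blk_range \<open>X \<noteq> {}\<close> assms(5) in \<open>auto simp: label_image_def\<close>)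
  have X: "X = seqs"
    using pres(4) by (simp add: seqs_def)
  have entropy: "component_entropy dd V E lab i C = htop (component_seqs V E (block_lab i) C)"
    if "i \<in> {1..s}" for i C
  proof -
    have "tau dd i \<circ> lab = block_lab i"
      using blk_iff[OF that] by (auto simp: tau_def block_lab_def fun_eq_iff restrict_def)
    then show ?thesis
      unfolding component_entropy_def component_seqs_def label_image_def image_image
      by (simp add: comp_assoc[symmetric])
  qed

  \<comment> \<open>The speed of the depth of block \<open>i\<close> relative to
    \<open>- ln \<delta>\<close>. The value 0 at \<open>i = 0\<close> matches both the depth 0 there
    and the convention for \<open>theta\<close>.\<close>
  define b where "b i = (if i = 0 then 0 else 1 / ln (real (n i)))" for i
  have ln_n: "0 < ln (real (n i))" if "i \<in> {1..s}" for i
    using n_ge[OF that] by simp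
  have b_nonneg: "0 \<le> b i" if "i \<le> s" for i
    using ln_n[of i] that by (cases "i = 0") (auto simp: b_def)
  have b_less: "b (i - 1) < b i" if "i \<in> {1..s}" for i
  proof (cases "i = 1")
    case True
    then show ?thesis using ln_n[OF that] by (simp add: b_def)
  next
    case False
    then have i: "i - 1 \<in> {1..s}" "i - 1 < i" using that by auto
    then have "n i < n (i - 1)" using that by (intro assms(3)) auto
    then have "ln (real (n i)) < ln (real (n (i - 1)))"
      using n_ge[OF that] by simp
    then show ?thesis
      using ln_n[OF that] ln_n[OF i(1)] i that by (auto simp: b_def intro: divide_strict_left_mono)
  qed
  define C where "C = component_chains V E s"
  define h where "h D i = htop (component_seqs V E (block_lab i) (D i))" for D :: "nat \<Rightarrow> 'v set" and i
  have C: "finite C" "C \<noteq> {}"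
    unfolding C_def using finite_component_chains component_chains_nonempty walks_nonempty by auto
  define t where "t \<delta> = - ln \<delta>" for \<delta> :: real
  have t: "filterlim t at_top (at_right 0)"
    unfolding t_def using ln_at_0 by (simp add: filterlim_uminus_at_bot)
  have small: "eventually (\<lambda>\<delta>. \<delta> \<in> {0<..<1}) (at_right (0 :: real))"
    by (rule eventually_at_right_real) simp
  have rate: "((\<lambda>\<delta>. ln (real (N_squares (L \<delta>))) / t \<delta>) \<longlongrightarrow>
      Max ((\<lambda>D. \<Sum>i = 1..s. h D i * (b i - b (i - 1))) ` C)) (at_right 0)"
    if L0: "\<And>\<delta>. L \<delta> 0 = 0"
      and L: "\<And>i. i \<le> s \<Longrightarrow> ((\<lambda>\<delta>. real (L \<delta> i) / t \<delta>) \<longlongrightarrow> b i) (at_right 0)"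
    for L :: "real \<Rightarrow> nat \<Rightarrow> nat"
  \<comment> \<open>The sum of the two thresholds serves the lower estimate, which asks for
    \<open>card E\<close>, as well as the upper one, which asks for \<open>card V\<close>.\<close>
  proof (rule growth_rate[where B = "card V + card E" and L = L and s = s and b = b and t = t and
        F = "at_right 0", OF t L b_less C])
    fix D assume "D \<in> C"
    then obtain c where "0 < c" and c: "\<forall>L. L 0 = 0 \<and> (\<forall>i\<in>{1..s}. L (i - 1) + card E \<le> L i) \<longrightarrow>
        c * exp (\<Sum>i = 1..s. h D i * real (steps L i)) \<le> real (N_squares L)"
      using N_squares_lower unfolding C_def h_def by blast
    have "c * exp (\<Sum>i = 1..s. h D i * real (steps (L \<delta>) i)) \<le> real (N_squares (L \<delta>))"
      if "\<forall>i\<in>{1..s}. L \<delta> (i - 1) + (card V + card E) \<le> L \<delta> i" for \<delta>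
    proof -
      have "\<forall>i\<in>{1..s}. L \<delta> (i - 1) + card E \<le> L \<delta> i"
        using that by fastforce
      then show ?thesis
        using c[THEN spec, of "L \<delta>"] L0 by blast
    qed
    with \<open>0 < c\<close> show "\<exists>c>0. \<forall>\<delta>. (\<forall>i\<in>{1..s}. L \<delta> (i - 1) + (card V + card E) \<le> L \<delta> i) \<longrightarrow>
        c * exp (\<Sum>i = 1..s. h D i * real (steps (L \<delta>) i)) \<le> real (N_squares (L \<delta>))"
      by blast
  next
    fix \<epsilon> :: real assume "0 < \<epsilon>"
    then obtain K where "0 < K" and K: "\<forall>L. L 0 = 0 \<and> (\<forall>i\<in>{1..s}. L (i - 1) + card V \<le> L i) \<longrightarrow>
        (\<exists>D\<in>C. real (N_squares L) \<le> K * exp (\<Sum>i = 1..s. (h D i + \<epsilon>) * real (steps L i)))"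
      using N_squares_upper unfolding C_def h_def by blast
    have "\<exists>D\<in>C. real (N_squares (L \<delta>)) \<le> K * exp (\<Sum>i = 1..s. (h D i + \<epsilon>) * real (steps (L \<delta>) i))"
      if "\<forall>i\<in>{1..s}. L \<delta> (i - 1) + (card V + card E) \<le> L \<delta> i" for \<delta>
    proof -
      have "\<forall>i\<in>{1..s}. L \<delta> (i - 1) + card V \<le> L \<delta> i"
        using that by fastforce
      then show ?thesis
        using K[THEN spec, of "L \<delta>"] L0 by blast
    qed
    with \<open>0 < K\<close> show "\<exists>K>0. \<forall>\<delta>. (\<forall>i\<in>{1..s}. L \<delta> (i - 1) + (card V + card E) \<le> L \<delta> i) \<longrightarrow>
        (\<exists>D\<in>C. real (N_squares (L \<delta>)) \<le> K * exp (\<Sum>i = 1..s. (h D i + \<epsilon>) * real (steps (L \<delta>) i)))"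
      by blast
  qed

  have t_gt: "0 < t \<delta>" if "\<delta> \<in> {0<..<1}" for \<delta>
    using that by (simp add: t_def)
  define M where "M = Max ((\<lambda>D. \<Sum>i = 1..s. h D i * (b i - b (i - 1))) ` C)"
  define d where "d = real CARD('d)"
  have d: "1 \<le> d" unfolding d_def by (simp add: Suc_leI)
  \<comment> \<open>\<open>L1\<close> rounds down, so that cells are at least \<delta> wide, as
    counting the codes per covering set requires. \<open>L2\<close> rounds up after adding
    \<open>ln d\<close>, so that boxes have diameter at most \<delta>. Both have the same
    speed.\<close>
  define L1 where "L1 \<delta> i = nat \<lfloor>t \<delta> * b i\<rfloor>" for \<delta> i
  define L2 where "L2 \<delta> i = nat \<lceil>(t \<delta> + ln d) * b i\<rceil>" for \<delta> i
  have L1_lim: "((\<lambda>\<delta>. real (L1 \<delta> i) / t \<delta>) \<longlongrightarrow> b i) (at_right 0)" if "i \<le> s" for i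
  proof (rule ratio_tendsto[OF t])
    show "eventually (\<lambda>\<delta>. \<bar>real (L1 \<delta> i) - t \<delta> * b i\<bar> \<le> 1) (at_right 0)"
      using small
    proof eventually_elim
      case (elim \<delta>)
      then have "0 \<le> t \<delta> * b i"
        using b_nonneg[OF that] t_gt[OF elim] by simp
      then have "real (L1 \<delta> i) = of_int \<lfloor>t \<delta> * b i\<rfloor>"
        by (simp add: L1_def)
      then show ?case
        using floor_correct[of "t \<delta> * b i"] by (intro abs_leI) linarith+
    qed
  qed
  have L2_lim: "((\<lambda>\<delta>. real (L2 \<delta> i) / t \<delta>) \<longlongrightarrow> b i) (at_right 0)" if "i \<le> s" for i
  proof (rule ratio_tendsto[OF t])
    show "eventually (\<lambda>\<delta>. \<bar>real (L2 \<delta> i) - t \<delta> * b i\<bar> \<le> 1 + ln d * b i) (at_right 0)"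
      using small
    proof eventually_elim
      case (elim \<delta>)
      have *: "0 \<le> t \<delta> * b i" "0 \<le> ln d * b i"
        using b_nonneg[OF that] t_gt[OF elim] d by simp_all
      moreover have "(t \<delta> + ln d) * b i = t \<delta> * b i + ln d * b i"
        by (simp add: distrib_right)
      moreover from calculation have "real (L2 \<delta> i) = of_int \<lceil>(t \<delta> + ln d) * b i\<rceil>"
        by (simp add: L2_def)
      ultimately show ?case
        using ceiling_correct[of "(t \<delta> + ln d) * b i"] by (intro abs_leI) linarith+
    qed
  qed
  have rate1: "((\<lambda>\<delta>. ln (real (N_squares (L1 \<delta>))) / t \<delta>) \<longlongrightarrow> M) (at_right 0)"
    unfolding M_def by (intro rate L1_lim) (simp add: L1_def b_def)
  have rate2: "((\<lambda>\<delta>. ln (real (N_squares (L2 \<delta>))) / t \<delta>) \<longlongrightarrow> M) (at_right 0)"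
    unfolding M_def by (intro rate L2_lim) (simp add: L2_def b_def)

  let ?cov = "\<lambda>\<delta>. covering_number (coding_map m ` X) \<delta>"
  have L1_scale: "\<delta> \<le> 1 / real (m r) ^ (L1 \<delta> \<circ> blk) r" if "\<delta> \<in> {0<..<1}" for \<delta> r
  proof -
    have ln_pos: "0 < ln (real (m r))" and b_eq: "b (blk r) = 1 / ln (real (m r))"
      using ln_n[OF blk_range[of r]] blk_range[of r] by (auto simp: m_blk b_def)
    have "0 \<le> t \<delta> * b (blk r)"
      using t_gt[OF that] b_nonneg[OF blk_le[of r]] by simp
    then have "real (L1 \<delta> (blk r)) \<le> t \<delta> * b (blk r)"
      unfolding L1_def by simp
    then have "real (L1 \<delta> (blk r)) * ln (real (m r)) \<le> t \<delta>"
      using ln_pos by (simp add: b_eq field_simps)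
    then have "real (m r) ^ L1 \<delta> (blk r) \<le> exp (t \<delta>)"
      unfolding power_eq_exp_ln[OF assms(2)] by simp
    also have "exp (t \<delta>) = 1 / \<delta>"
      using that by (simp add: t_def exp_minus field_simps)
    finally show ?thesis
      using that assms(2)[of r] by (simp add: field_simps)
  qed
  have L2_scale: "real CARD('d) / real (m r) ^ (L2 \<delta> \<circ> blk) r \<le> \<delta>" if "\<delta> \<in> {0<..<1}" for \<delta> r
  proof -
    have ln_pos: "0 < ln (real (m r))" and b_eq: "b (blk r) = 1 / ln (real (m r))"
      using ln_n[OF blk_range[of r]] blk_range[of r] by (auto simp: m_blk b_def)
    have "(t \<delta> + ln d) * b (blk r) \<le> real (L2 \<delta> (blk r))"
      unfolding L2_def by linarith
    then have "t \<delta> + ln d \<le> real (L2 \<delta> (blk r)) * ln (real (m r))"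
      using ln_pos by (simp add: b_eq field_simps)
    then have "exp (t \<delta> + ln d) \<le> real (m r) ^ L2 \<delta> (blk r)"
      unfolding power_eq_exp_ln[OF assms(2)] by simp
    moreover have "exp (t \<delta> + ln d) = d / \<delta>"
      using that d by (simp add: t_def exp_diff)
    ultimately show ?thesis
      using that assms(2)[of r] by (simp add: d_def field_simps)
  qed
  \<comment> \<open>The factor \<open>5 ^ CARD('d)\<close> turns into the additive term
    \<open>d * ln 5\<close>, which vanishes in the limit after division by
    \<open>t \<delta>\<close>.\<close>
  have bounds: "eventually (\<lambda>\<delta>. ln (real (N_squares (L1 \<delta>))) / t \<delta> - d * ln 5 / t \<delta> \<le> ln (real (?cov \<delta>)) / t \<delta> \<and>
      ln (real (?cov \<delta>)) / t \<delta> \<le> ln (real (N_squares (L2 \<delta>))) / t \<delta>) (at_right 0)"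
    using small
  proof eventually_elim
    case (elim \<delta>)
    note t_pos = t_gt[OF elim]
    have "N_squares (L1 \<delta>) \<le> ?cov \<delta> * 5 ^ CARD('d)"
      unfolding N_squares_def X
      by (rule card_square_codes_le[OF assms(2) seqs_digit_seqs L2_scale[OF elim] L1_scale[OF elim]])
    then have le1: "real (N_squares (L1 \<delta>)) \<le> real (?cov \<delta>) * 5 ^ CARD('d)"
      using of_nat_mono[where 'a = real] by fastforce
    have le2: "?cov \<delta> \<le> N_squares (L2 \<delta>)"
      unfolding N_squares_def X
      by (rule covering_number_le[OF assms(2) seqs_digit_seqs L2_scale[OF elim]])
    have pos1: "0 < N_squares (L1 \<delta>)"
      unfolding N_squares_def using finite_square_codes[OF assms(2) seqs_digit_seqs] seqs_nonempty
      by (simp add: card_gt_0_iff)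
    \<comment> \<open>A covering number 0 would contradict \<open>le1\<close>, so the logarithm
      below is taken of a positive number.\<close>
    have pos2: "0 < ?cov \<delta>"
      using pos1 le1 by (cases "?cov \<delta> = 0") auto
    have "ln (real (N_squares (L1 \<delta>))) \<le> ln (real (?cov \<delta>) * 5 ^ CARD('d))"
      using pos1 le1 by (intro ln_mono) auto
    also have "\<dots> = ln (real (?cov \<delta>)) + d * ln 5"
      using pos2 by (simp add: ln_mult ln_realpow d_def)
    finally have "(ln (real (N_squares (L1 \<delta>))) - d * ln 5) / t \<delta> \<le> ln (real (?cov \<delta>)) / t \<delta>"
      using t_pos by (intro divide_right_mono) auto
    moreover have "ln (real (?cov \<delta>)) / t \<delta> \<le> ln (real (N_squares (L2 \<delta>))) / t \<delta>"
      using pos2 le2 t_pos by (intro divide_right_mono ln_mono) auto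
    ultimately show ?case
      by (simp add: diff_divide_distrib)
  qed
  have rate1': "((\<lambda>\<delta>. ln (real (N_squares (L1 \<delta>))) / t \<delta> - d * ln 5 / t \<delta>) \<longlongrightarrow> M) (at_right 0)"
    using tendsto_diff[OF rate1 real_tendsto_divide_at_top[OF tendsto_const t]] by simp
  have cov_lim: "((\<lambda>\<delta>. ln (real (?cov \<delta>)) / t \<delta>) \<longlongrightarrow> M) (at_right 0)"
    by (rule tendsto_sandwich[OF _ _ rate1' rate2]) (use bounds in \<open>simp_all add: eventually_conj_iff\<close>)

  have "ln (real (n s)) \<noteq> 0" "0 \<le> 1 / ln (real (n s))"
    using ln_n[of s] assms(5) by auto
  \<comment> \<open>The conventions for \<open>theta\<close> and \<open>b\<close> at 0 agree, so
    \<open>i = 1\<close> is no special case.\<close>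
  have theta: "theta n s i - theta n s (i - 1) = ln (real (n s)) * (b i - b (i - 1))" for i
    by (simp add: theta_def b_def right_diff_distrib)
  define S where "S D = (\<Sum>i = 1..s. (theta n s i - theta n s (i - 1)) * component_entropy dd V E lab i (D i))" for D
  have "(\<Sum>i = 1..s. h D i * (b i - b (i - 1))) = 1 / ln (real (n s)) * S D" for D
    unfolding S_def sum_distrib_left using \<open>ln (real (n s)) \<noteq> 0\<close>
    by (intro sum.cong refl) (simp only: theta, simp add: entropy h_def)
  then have "M = Max ((\<lambda>x. 1 / ln (real (n s)) * x) ` S ` C)"
    by (simp add: M_def image_image)
  also have "\<dots> = 1 / ln (real (n s)) * Max (S ` C)"
    using C \<open>0 \<le> 1 / ln (real (n s))\<close>
    by (intro mono_Max_commute[of "\<lambda>x. 1 / ln (real (n s)) * x", symmetric] monoI mult_left_mono) auto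
  also have "S ` C = {\<Sum>i = 1..s. (theta n s i - theta n s (i - 1)) * component_entropy dd V E lab i (D i)
            | D. D \<in> component_chains V E s}"
    by (auto simp: S_def C_def)
  finally show ?thesis
    using cov_lim unfolding has_box_dimension_def t_def by simp
qed

end
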